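(* Thompson's group $T$ is not invariably generated.
   Context: $S^1$ is the interval $[0,1]$ with $0$ and $1$ identified. Thompson's group $T$ is the group of piecewise linear orientation-preserving homeomorphisms of $S^1$ which preserve the set of finite dyadic fractions, have finitely many breakpoints, all at finite dyadic fractions, and all slopes integer powers of $2$. A group $G$ is invariably generated if there is a subset $S\subseteq G$ such that $G=\langle s^{g(s)}: s\in S\rangle$ for every choice of $g(s)\in G$, $s\in S$; equivalently, no proper subgroup of $G$ meets every conjugacy class of $G$. *)

theory Defs
  imports Complex_Main "HOL-Algebra.Generated_Groups"
begin

definition dyadic :: "real \<Rightarrow> bool" where
  "dyadic x \<longleftrightarrow> (\<exists>m::int. \<exists>n::nat. x = real_of_int m / 2 ^ n)"

text \<open>S^1 = [0,1] with 0 ~ 1, represented by [0,1) via frac.  An element of T is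
  given through its lift F : R -> R (a continuous, strictly increasing map with
  F(x+1) = F(x) + 1, i.e. an orientation-preserving circle homeomorphism), which is
  piecewise linear with finitely many breakpoints in [0,1], all dyadic, all slopes
  integer powers of 2, and which preserves the dyadic rationals.\<close>
definition thompson_lift :: "(real \<Rightarrow> real) \<Rightarrow> bool" where
  "thompson_lift F \<longleftrightarrow>
     continuous_on UNIV F \<and> strict_mono F \<and> (\<forall>x. F (x + 1) = F x + 1) \<and>
     (\<forall>x. dyadic x \<longleftrightarrow> dyadic (F x)) \<and>
     (\<exists>B. finite B \<and> (\<forall>b\<in>B. dyadic b) \<and>
        (\<forall>x\<in>{0..1} - B. \<exists>k::int. \<exists>e>0. \<forall>y. \<bar>y - x\<bar> < e \<longrightarrow>
              F y = F x + 2 powr (real_of_int k) * (y - x)))"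

definition thompson_T_set :: "(real \<Rightarrow> real) set" where
  "thompson_T_set = {(\<lambda>x. frac (F x)) | F. thompson_lift F}"

definition thompson_T :: "(real \<Rightarrow> real) monoid" where
  "thompson_T = \<lparr>carrier = thompson_T_set, mult = (\<circ>), one = frac\<rparr>"

definition invariably_generated :: "('a, 'b) monoid_scheme \<Rightarrow> bool" where
  "invariably_generated G \<longleftrightarrow>
     (\<exists>S \<subseteq> carrier G. \<forall>g \<in> S \<rightarrow> carrier G.
        generate G ((\<lambda>s. inv\<^bsub>G\<^esub> (g s) \<otimes>\<^bsub>G\<^esub> s \<otimes>\<^bsub>G\<^esub> g s) ` S) = carrier G)"

end

theory Submission
  imports Defs "HOL-Library.Countable_Set"
begin

text \<open>
  Ping-pong. Suppose that every \<open>s \<in> T\<close> has an interval \<open>I\<close> of the circle with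
  \<open>s\<^sup>k I \<inter> I = {}\<close> whenever \<open>s\<^sup>k \<noteq> 1\<close>. Since \<open>T\<close> is countable, one can choose
  pairwise disjoint intervals \<open>J\<^sub>s \<subseteq> [0, 1/2)\<close>, and an element \<open>g\<^sub>s \<in> T\<close> that maps the
  complement of \<open>J\<^sub>s\<close> into \<open>I\<close>. The nontrivial powers of the conjugate of \<open>s\<close> by \<open>g\<^sub>s\<close>
  then map the complement of \<open>J\<^sub>s\<close> into \<open>J\<^sub>s\<close>, so the orbit of \<open>1/2\<close> under the group
  generated by these conjugates lies in \<open>{1/2} \<union> (\<Union>s. J\<^sub>s)\<close>. It misses \<open>3/4\<close>, although
  the rotation by \<open>1/4\<close> belongs to \<open>T\<close>.

  The interval \<open>I\<close> exists as soon as \<open>s\<close> has a periodic point: if \<open>q\<close> is the minimal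
  period and \<open>s\<^sup>q \<noteq> 1\<close>, take \<open>I\<close> between a point \<open>c\<close> and \<open>s\<^sup>q c \<noteq> c\<close>.

  Periodic points exist by a Denjoy-type argument. Suppose that the lift \<open>F\<close> has none, and let
  \<open>W\<close> be the open invariant set of points with a neighbourhood whose forward images shrink to
  length \<open>0\<close>. It contains every dyadic \<open>y\<close>: the points \<open>F\<^sup>n y\<close> are distinct
  modulo \<open>1\<close>, so their denominators tend to infinity, and for large denominators the slope of
  \<open>F\<close> is exactly the factor by which the denominator decreases. If \<open>a \<notin> W\<close> is the right end
  point of an interval \<open>[0, a) \<subseteq> W\<close>, then the images of \<open>[0, a)\<close> are disjoint modulo
  \<open>1\<close>, hence shrink; as the breakpoints lie in \<open>W\<close>, far along the orbit of \<open>a\<close> the map is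
  affine at the scale of these images, so the intervals on the other side of \<open>F\<^sup>n a\<close> shrink
  too, and \<open>a \<in> W\<close>. Thus \<open>W\<close> is the whole line, which is absurd because
  \<open>F\<^sup>n 1 - F\<^sup>n 0 = 1\<close>.
\<close>

section \<open>Lifts of circle homeomorphisms\<close>

text \<open>The part of \<open>thompson_lift\<close> that concerns every circle homeomorphism, split
  off because most of the dynamics needs nothing else. Surjectivity is derived in
  \<open>degree_one_surj\<close>.\<close>

definition degree_one :: "(real \<Rightarrow> real) \<Rightarrow> bool" where
  "degree_one F \<longleftrightarrow> continuous_on UNIV F \<and> strict_mono F \<and> (\<forall>x. F (x + 1) = F x + 1)"

lemma degree_one_add_int:
  assumes "degree_one F"
  shows "F (x + of_int m) = F x + of_int m"
proof -
  have one: "F (y + 1) = F y + 1" for y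
    using assms by (simp add: degree_one_def)
  have nat: "F (y + of_nat n) = F y + of_nat n" for y n
  proof (induction n)
    case (Suc n)
    have "F (y + of_nat (Suc n)) = F ((y + of_nat n) + 1)"
      by (simp add: algebra_simps)
    then show ?case using one[of "y + of_nat n"] Suc by simp
  qed simp
  show ?thesis
  proof (cases "m \<ge> 0")
    case True
    then show ?thesis using nat[of x "nat m"] by simp
  next
    case False
    then show ?thesis using nat[of "x + of_int m" "nat (- m)"] by simp
  qed
qed

lemma degree_one_diff_int:
  assumes "degree_one F"
  shows "F (x - of_int m) = F x - of_int m"
  using degree_one_add_int[OF assms, of x "- m"] by simp

lemma degree_one_less_iff: "degree_one F \<Longrightarrow> F x < F y \<longleftrightarrow> x < y"
  and degree_one_le_iff: "degree_one F \<Longrightarrow> F x \<le> F y \<longleftrightarrow> x \<le> y"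
  and degree_one_eq_iff: "degree_one F \<Longrightarrow> F x = F y \<longleftrightarrow> x = y"
  by (auto simp: degree_one_def strict_mono_less strict_mono_less_eq strict_mono_eq)

lemma degree_one_isCont: "degree_one F \<Longrightarrow> isCont F x"
  by (simp add: degree_one_def continuous_on_eq_continuous_at)

lemma degree_one_comp:
  assumes "degree_one F" "degree_one G"
  shows "degree_one (F \<circ> G)"
  unfolding degree_one_def
proof (intro conjI allI)
  show "continuous_on UNIV (F \<circ> G)"
    using assms unfolding degree_one_def
    by (intro continuous_on_compose) (auto intro: continuous_on_subset)
  show "strict_mono (F \<circ> G)"
    using assms by (auto simp: degree_one_def strict_mono_def)
qed (use assms in \<open>auto simp: degree_one_def\<close>)

lemma degree_one_funpow: "degree_one F \<Longrightarrow> degree_one (F ^^ n)"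
proof (induction n)
  case 0
  show ?case by (auto simp: degree_one_def strict_mono_def id_def)
next
  case (Suc n)
  then show ?case using degree_one_comp[of F "F ^^ n"] by (simp add: comp_def)
qed

text \<open>The values at the integers \<open>m\<close> are \<open>F 0 + m\<close>, so two
  consecutive ones enclose \<open>y\<close> and the intermediate value theorem applies.\<close>

lemma degree_one_surj:
  assumes F: "degree_one F"
  obtains x where "F x = y"
proof -
  have lo: "F (0 + of_int \<lfloor>y - F 0\<rfloor>) \<le> y"
    unfolding degree_one_add_int[OF F] by linarith
  have hi: "y \<le> F (0 + of_int (\<lfloor>y - F 0\<rfloor> + 1))"
    unfolding degree_one_add_int[OF F] by linarith
  have "\<exists>x\<ge>of_int \<lfloor>y - F 0\<rfloor>. x \<le> of_int (\<lfloor>y - F 0\<rfloor> + 1) \<and> F x = y"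
    using lo hi by (intro IVT') (use F in \<open>auto simp: degree_one_def intro: continuous_on_subset\<close>)
  then show ?thesis using that by blast
qed

text \<open>Because of this, composing circle maps amounts to composing their lifts.\<close>

lemma frac_degree_one_frac:
  assumes "degree_one F"
  shows "frac (F (frac x)) = frac (F x)"
proof -
  have "F (frac x) = F x - of_int \<lfloor>x\<rfloor>"
    unfolding frac_def by (rule degree_one_diff_int[OF assms])
  then show ?thesis by (simp add: frac_def)
qed

lemma frac_eq_frac_iff: "frac x = frac y \<longleftrightarrow> (\<exists>m::int. x = y + of_int m)"
proof
  assume "frac x = frac y"
  then have "x = y + of_int (\<lfloor>x\<rfloor> - \<lfloor>y\<rfloor>)" by (simp add: frac_def algebra_simps)
  then show "\<exists>m::int. x = y + of_int m" ..
qed (auto simp: frac_def)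

section \<open>Piecewise affine lifts: breakpoints modulo 1, composition, inverse\<close>

definition pow2_affine_at :: "(real \<Rightarrow> real) \<Rightarrow> real \<Rightarrow> bool" where
  "pow2_affine_at F x \<longleftrightarrow>
     (\<exists>k::int. \<exists>e>0. \<forall>y. \<bar>y - x\<bar> < e \<longrightarrow> F y = F x + 2 powr (real_of_int k) * (y - x))"

lemma pow2_affine_at_frac:
  assumes F: "degree_one F" and "pow2_affine_at F (frac x)"
  shows "pow2_affine_at F x"
proof -
  obtain k :: int and e where "e > 0" and
    e: "\<And>y. \<bar>y - frac x\<bar> < e \<Longrightarrow> F y = F (frac x) + 2 powr (real_of_int k) * (y - frac x)"
    using assms(2) unfolding pow2_affine_at_def by blast
  have "F y = F x + 2 powr (real_of_int k) * (y - x)" if "\<bar>y - x\<bar> < e" for y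
    using e[of "y - of_int \<lfloor>x\<rfloor>"] that degree_one_diff_int[OF F] by (simp add: frac_def)
  with \<open>e > 0\<close> show ?thesis unfolding pow2_affine_at_def by blast
qed

text \<open>Reading the breakpoints modulo \<open>1\<close> gives a condition on the whole line,
  which passes to composites and inverses without special care at the ends of
  \<open>[0, 1]\<close>.\<close>

lemma thompson_lift_iff:
  "thompson_lift F \<longleftrightarrow> degree_one F \<and> (\<forall>x. dyadic x \<longleftrightarrow> dyadic (F x)) \<and>
     (\<exists>B. finite B \<and> (\<forall>b\<in>B. dyadic b) \<and> (\<forall>x. frac x \<notin> B \<longrightarrow> pow2_affine_at F x))"
proof -
  have "(\<exists>B. finite B \<and> (\<forall>b\<in>B. dyadic b) \<and> (\<forall>x\<in>{0..1} - B. pow2_affine_at F x)) \<longleftrightarrow>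
     (\<exists>B. finite B \<and> (\<forall>b\<in>B. dyadic b) \<and> (\<forall>x. frac x \<notin> B \<longrightarrow> pow2_affine_at F x))"
    (is "?L \<longleftrightarrow> ?R") if F: "degree_one F"
  proof
    assume ?L
    then obtain B where B: "finite B" "\<forall>b\<in>B. dyadic b" "\<forall>x\<in>{0..1} - B. pow2_affine_at F x"
      by blast
    have "pow2_affine_at F x" if "frac x \<notin> B" for x
      by (rule pow2_affine_at_frac[OF F]) (use B(3) that in \<open>simp add: less_imp_le[OF frac_lt_1]\<close>)
    with B show ?R by blast
  next
    assume ?R
    then obtain B where B: "finite B" "\<forall>b\<in>B. dyadic b" "\<And>x. frac x \<notin> B \<Longrightarrow> pow2_affine_at F x"
      by blast
    \<comment> \<open>\<open>1\<close> is the only point of \<open>[0, 1]\<close> that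
      \<open>frac\<close> moves, hence it joins the exceptional set.\<close>
    have "dyadic 1" unfolding dyadic_def by (intro exI[of _ 1] exI[of _ 0]) simp
    moreover have "pow2_affine_at F x" if "x \<in> {0..1} - insert 1 B" for x
    proof -
      have "frac x = x" using that by (simp add: frac_eq)
      then show ?thesis using that B(3)[of x] by simp
    qed
    ultimately show ?L using B by (intro exI[of _ "insert 1 B"]) auto
  qed
  moreover have "thompson_lift F \<longleftrightarrow> degree_one F \<and> (\<forall>x. dyadic x \<longleftrightarrow> dyadic (F x)) \<and>
     (\<exists>B. finite B \<and> (\<forall>b\<in>B. dyadic b) \<and> (\<forall>x\<in>{0..1} - B. pow2_affine_at F x))"
    unfolding thompson_lift_def degree_one_def pow2_affine_at_def by (simp only: conj_assoc)
  ultimately show ?thesis by (simp only: cong: conj_cong)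
qed

lemma dyadic_add: "dyadic x \<Longrightarrow> dyadic y \<Longrightarrow> dyadic (x + y)"
proof -
  assume "dyadic x" "dyadic y"
  then obtain m n m' n' where "x = real_of_int m / 2 ^ n" "y = real_of_int m' / 2 ^ n'"
    unfolding dyadic_def by blast
  then have "x + y = real_of_int (m * 2 ^ n' + m' * 2 ^ n) / 2 ^ (n + n')"
    by (simp add: add_divide_distrib power_add)
  then show ?thesis unfolding dyadic_def by blast
qed

lemma dyadic_minus: "dyadic x \<Longrightarrow> dyadic (- x)"
  unfolding dyadic_def by (metis minus_divide_left of_int_minus)

lemma dyadic_of_int: "dyadic (of_int m)"
  unfolding dyadic_def by (rule exI[of _ m], rule exI[of _ 0]) simp

lemma dyadic_div_power: "dyadic (of_int m / 2 ^ n)"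
  unfolding dyadic_def by blast

lemma dyadic_add_iff: "dyadic y \<Longrightarrow> dyadic (x + y) \<longleftrightarrow> dyadic x"
  using dyadic_add[of "x + y" "- y"] dyadic_add[of x y] dyadic_minus[of y] by auto

lemma dyadic_frac_iff: "dyadic (frac x) \<longleftrightarrow> dyadic x"
  using dyadic_add_iff[OF dyadic_of_int, of x "- \<lfloor>x\<rfloor>"] by (simp add: frac_def)

lemma pow2_affine_at_comp:
  assumes "pow2_affine_at F (G x)" "pow2_affine_at G x"
  shows "pow2_affine_at (F \<circ> G) x"
proof -
  obtain k :: int and e where "e > 0" and
    e: "\<And>y. \<bar>y - G x\<bar> < e \<Longrightarrow> F y = F (G x) + 2 powr (real_of_int k) * (y - G x)"
    using assms(1) unfolding pow2_affine_at_def by blast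
  obtain l :: int and d where "d > 0" and
    d: "\<And>y. \<bar>y - x\<bar> < d \<Longrightarrow> G y = G x + 2 powr (real_of_int l) * (y - x)"
    using assms(2) unfolding pow2_affine_at_def by blast
  have "(F \<circ> G) y = (F \<circ> G) x + 2 powr (real_of_int (k + l)) * (y - x)"
    if y: "\<bar>y - x\<bar> < min d (e / 2 powr l)" for y
  proof -
    have Gy: "G y = G x + 2 powr (real_of_int l) * (y - x)" using d y by simp
    have "2 powr l * \<bar>y - x\<bar> < e" using y by (simp add: field_simps)
    then have "\<bar>G y - G x\<bar> < e" by (simp add: Gy abs_mult)
    then show ?thesis using e[of "G y"] by (simp add: Gy powr_add)
  qed
  moreover have "min d (e / 2 powr l) > 0" using \<open>d > 0\<close> \<open>e > 0\<close> by simp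
  ultimately show ?thesis unfolding pow2_affine_at_def by blast
qed

lemma thompson_lift_degree_one: "thompson_lift F \<Longrightarrow> degree_one F"
  and thompson_lift_dyadic: "thompson_lift F \<Longrightarrow> dyadic (F x) \<longleftrightarrow> dyadic x"
  by (auto simp: thompson_lift_iff)

lemma thompson_lift_comp:
  assumes F: "thompson_lift F" and G: "thompson_lift G"
  shows "thompson_lift (F \<circ> G)"
proof -
  note dF = thompson_lift_degree_one[OF F] and dG = thompson_lift_degree_one[OF G]
  obtain B where B: "finite B" "\<forall>b\<in>B. dyadic b" "\<And>x. frac x \<notin> B \<Longrightarrow> pow2_affine_at F x"
    using F unfolding thompson_lift_iff by blast
  obtain C where C: "finite C" "\<forall>b\<in>C. dyadic b" "\<And>x. frac x \<notin> C \<Longrightarrow> pow2_affine_at G x"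
    using G unfolding thompson_lift_iff by blast
  \<comment> \<open>A composite can break only where \<open>G\<close> does or where \<open>G\<close>
    hits a breakpoint of \<open>F\<close>; the second set is finite because \<open>G\<close> is
    injective modulo \<open>1\<close>.\<close>
  define D where "D = C \<union> {x \<in> {0..<1}. frac (G x) \<in> B}"
  have inj: "inj_on (\<lambda>x. frac (G x)) {0..<1}"
  proof (rule inj_onI)
    fix x y :: real assume xy: "x \<in> {0..<1}" "y \<in> {0..<1}" "frac (G x) = frac (G y)"
    then obtain m :: int where "G x = G y + of_int m" by (auto simp: frac_eq_frac_iff)
    then have "x = y + of_int m"
      using degree_one_eq_iff[OF dG, of x "y + of_int m"] degree_one_add_int[OF dG] by simp
    then have "frac x = frac y" by (auto simp: frac_eq_frac_iff)
    then show "x = y" using xy by (simp add: frac_eq[THEN iffD2])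
  qed
  have "finite ((\<lambda>x. frac (G x)) -` B \<inter> {0..<1})"
    by (rule finite_vimage_IntI[OF B(1) inj])
  then have "finite D" unfolding D_def using C(1)
    by (auto elim!: rev_finite_subset)
  moreover have "\<forall>b\<in>D. dyadic b"
    unfolding D_def using B(2) C(2) G by (auto simp: dyadic_frac_iff thompson_lift_dyadic)
  moreover have "pow2_affine_at (F \<circ> G) x" if "frac x \<notin> D" for x
  proof (rule pow2_affine_at_comp)
    show "pow2_affine_at G x" using that C(3) by (simp add: D_def)
    have "frac (G x) \<notin> B"
      using that frac_degree_one_frac[OF dG, of x] by (auto simp: D_def frac_lt_1)
    then show "pow2_affine_at F (G x)" by (rule B(3))
  qed
  moreover have "dyadic x \<longleftrightarrow> dyadic ((F \<circ> G) x)" for x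
    by (simp add: thompson_lift_dyadic F G)
  ultimately show ?thesis
    using degree_one_comp[OF dF dG] unfolding thompson_lift_iff by blast
qed

lemma thompson_lift_funpow:
  assumes "thompson_lift F"
  shows "thompson_lift (F ^^ n)"
proof (induction n)
  case 0
  have "pow2_affine_at id x" for x
    unfolding pow2_affine_at_def by (rule exI[of _ 0], rule exI[of _ 1]) simp
  then show ?case
    using degree_one_funpow[OF thompson_lift_degree_one[OF assms], of 0]
    unfolding thompson_lift_iff by (intro conjI exI[of _ "{}"]) (simp_all add: id_def)
next
  case (Suc n)
  then show ?case using thompson_lift_comp[OF assms] by (simp add: comp_def)
qed

text \<open>The inverse can break only at the images of the breakpoints of \<open>F\<close>, and it
  has slope \<open>2^-k\<close> where \<open>F\<close> has slope \<open>2^k\<close>.\<close>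

lemma thompson_lift_inverse:
  assumes F: "thompson_lift F"
  obtains G where "thompson_lift G" "\<And>x. F (G x) = x" "\<And>x. G (F x) = x"
proof -
  note dF = thompson_lift_degree_one[OF F]
  obtain B where B: "finite B" "\<forall>b\<in>B. dyadic b" "\<And>x. frac x \<notin> B \<Longrightarrow> pow2_affine_at F x"
    using F unfolding thompson_lift_iff by blast
  have "\<forall>y. \<exists>x. F x = y" by (meson degree_one_surj[OF dF])
  then obtain G where FG: "\<And>y. F (G y) = y" by metis
  have GF: "G (F x) = x" for x
    using FG[of "F x"] degree_one_eq_iff[OF dF] by simp
  have "isCont G x" for x
    using isCont_inverse_function[of 1 "G x" G F] GF degree_one_isCont[OF dF] FG
    by simp
  moreover have "strict_mono G"
    by (rule strict_monoI) (metis FG degree_one_less_iff[OF dF])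
  moreover have "G (x + 1) = G x + 1" for x
    using degree_one_eq_iff[OF dF] FG dF unfolding degree_one_def by metis
  ultimately have dG: "degree_one G"
    unfolding degree_one_def by (auto simp: continuous_on_eq_continuous_at)
  have "pow2_affine_at G y" if "frac y \<notin> (\<lambda>b. frac (F b)) ` B" for y
  proof -
    have "frac (G y) \<notin> B"
      using that frac_degree_one_frac[OF dF, of "G y"] FG by force
    then obtain k :: int and e where "e > 0" and
      e: "\<And>x. \<bar>x - G y\<bar> < e \<Longrightarrow> F x = F (G y) + 2 powr (real_of_int k) * (x - G y)"
      using B(3) unfolding pow2_affine_at_def by blast
    have "G z = G y + 2 powr (real_of_int (- k)) * (z - y)" if z: "\<bar>z - y\<bar> < 2 powr k * e" for z
    proof -
      let ?x = "G y + 2 powr (real_of_int (- k)) * (z - y)"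
      have "\<bar>?x - G y\<bar> < e" using z by (simp add: abs_mult powr_minus field_simps)
      then have "F ?x = z" using e[of ?x] FG by (simp add: powr_minus field_simps)
      then show ?thesis using GF[of ?x] by simp
    qed
    moreover have "2 powr k * e > 0" using \<open>e > 0\<close> by simp
    ultimately show ?thesis unfolding pow2_affine_at_def by blast
  qed
  moreover have "dyadic (G x) \<longleftrightarrow> dyadic x" for x
    using thompson_lift_dyadic[OF F, of "G x"] FG by simp
  moreover have "\<forall>b\<in>(\<lambda>b. frac (F b)) ` B. dyadic b"
    using B(2) by (auto simp: dyadic_frac_iff thompson_lift_dyadic[OF F])
  ultimately have "thompson_lift G"
    unfolding thompson_lift_iff using dG B(1) by (metis finite_imageI)
  with FG GF show ?thesis using that by blast
qed

section \<open>Dyadic grids, denominators and countability\<close>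

lemma common_dyadic_denominator:
  assumes "finite B" "\<forall>b\<in>B. dyadic b"
  obtains N where "\<And>b. b \<in> B \<Longrightarrow> \<exists>m::int. b = of_int m / 2 ^ N"
proof -
  have "\<exists>N. \<forall>b\<in>B. \<exists>m::int. b = of_int m / 2 ^ N"
    using assms
  proof (induction B)
    case (insert b B)
    then obtain N where N: "\<forall>b\<in>B. \<exists>m::int. b = of_int m / 2 ^ N" by auto
    obtain m :: int and n where b: "b = of_int m / 2 ^ n" using insert.prems by (auto simp: dyadic_def)
    have "b = of_int (m * 2 ^ N) / 2 ^ (n + N)" by (simp add: b power_add)
    moreover have "\<exists>l::int. c = of_int l / 2 ^ (n + N)" if c: "c \<in> B" for c
    proof -
      obtain l :: int where "c = of_int l / 2 ^ N" using bspec[OF N c] by blast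
      then have "c = of_int (l * 2 ^ n) / 2 ^ (n + N)" by (simp add: power_add)
      then show ?thesis ..
    qed
    ultimately show ?case by blast
  qed simp
  then show ?thesis using that by blast
qed

text \<open>The grid of mesh \<open>2^-N\<close> contains all breakpoints, so inside a cell the
  slope is locally constant, hence constant by connectedness.\<close>

lemma thompson_lift_affine_on_cells:
  assumes F: "thompson_lift F"
  obtains N where "\<And>i::int. \<exists>k::int. \<forall>x\<in>{of_int i / 2 ^ N..of_int (i + 1) / 2 ^ N}.
    F x = F (of_int i / 2 ^ N) + 2 powr of_int k * (x - of_int i / 2 ^ N)"
proof -
  obtain B where B: "finite B" "\<forall>b\<in>B. dyadic b" "\<And>x. frac x \<notin> B \<Longrightarrow> pow2_affine_at F x"
    using F unfolding thompson_lift_iff by blast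
  obtain N where N: "\<And>b. b \<in> B \<Longrightarrow> \<exists>m::int. b = of_int m / 2 ^ N"
    using common_dyadic_denominator[OF B(1,2)] by blast
  have "\<exists>k::int. \<forall>x\<in>{of_int i / 2 ^ N..of_int (i + 1) / 2 ^ N}.
    F x = F (of_int i / 2 ^ N) + 2 powr of_int k * (x - of_int i / 2 ^ N)" for i :: int
  proof -
    define a b where "a = real_of_int i / 2 ^ N" and "b = real_of_int (i + 1) / 2 ^ N"
    have "a < b" by (simp add: a_def b_def divide_strict_right_mono)
    have aff: "pow2_affine_at F x" if x: "x \<in> {a<..<b}" for x
    proof (rule B(3), rule notI)
      assume "frac x \<in> B"
      then obtain m :: int where m: "frac x = of_int m / 2 ^ N" using N by blast
      have "x = of_int (m + \<lfloor>x\<rfloor> * 2 ^ N) / 2 ^ N"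
        using m by (simp add: frac_def field_simps)
      with x have "real_of_int i < of_int (m + \<lfloor>x\<rfloor> * 2 ^ N)" "real_of_int (m + \<lfloor>x\<rfloor> * 2 ^ N) < of_int (i + 1)"
        unfolding a_def b_def
        by (metis divide_less_cancel greaterThanLessThan_iff not_less_iff_gr_or_eq zero_less_numeral zero_less_power)+
      then show False unfolding of_int_less_iff by linarith
    qed
    then have "\<forall>x\<in>{a<..<b}. \<exists>k::int. \<exists>e>0. \<forall>y. \<bar>y - x\<bar> < e \<longrightarrow> F y = F x + 2 powr of_int k * (y - x)"
      unfolding pow2_affine_at_def by blast
    from bchoice[OF this] obtain k :: "real \<Rightarrow> int" where k: "\<And>x. x \<in> {a<..<b} \<Longrightarrow>
        \<exists>e>0. \<forall>y. \<bar>y - x\<bar> < e \<longrightarrow> F y = F x + 2 powr of_int (k x) * (y - x)"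
      by blast
    have deriv: "\<exists>e>0. \<forall>y. \<bar>y - x\<bar> < e \<longrightarrow> (F has_real_derivative 2 powr of_int (k x)) (at y)"
      if x: "x \<in> {a<..<b}" for x
    proof -
      obtain e where "e > 0" and e: "\<And>y. \<bar>y - x\<bar> < e \<Longrightarrow> F y = F x + 2 powr of_int (k x) * (y - x)"
        using k[OF x] by blast
      have "(F has_real_derivative 2 powr of_int (k x)) (at y)" if y: "\<bar>y - x\<bar> < e" for y
      proof (rule has_field_derivative_transform_within_open)
        show "((\<lambda>y. F x + 2 powr of_int (k x) * (y - x)) has_real_derivative 2 powr of_int (k x)) (at y)"
          by (auto intro!: derivative_eq_intros)
        show "open {x - e<..<x + e}" by simp
        show "y \<in> {x - e<..<x + e}" using y by auto
      next
        fix z assume "z \<in> {x - e<..<x + e}"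
        then show "F x + 2 powr of_int (k x) * (z - x) = F z" by (intro e[symmetric]) auto
      qed
      with \<open>e > 0\<close> show ?thesis by blast
    qed
    have deriv_at: "(F has_real_derivative 2 powr of_int (k x)) (at x)" if x: "x \<in> {a<..<b}" for x
      using deriv[OF x] by (elim exE conjE) (drule spec[of _ x], simp)
    define c where "c = (a + b) / 2"
    have c: "c \<in> {a<..<b}" using \<open>a < b\<close> by (simp add: c_def field_simps)
    \<comment> \<open>Nearby local slopes agree because both are the derivative of \<open>F\<close>
      at the same point.\<close>
    have const: "2 powr real_of_int (k x) = 2 powr real_of_int (k c)" if x: "x \<in> {a<..<b}" for x
    proof (rule connected_local_const[where A = "{a<..<b}" and f = "\<lambda>x. 2 powr real_of_int (k x)"])
      show "\<forall>u\<in>{a<..<b}. \<forall>\<^sub>F v in at u within {a<..<b}. 2 powr real_of_int (k u) = 2 powr real_of_int (k v)"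
      proof
        fix u assume u: "u \<in> {a<..<b}"
        obtain e where "e > 0" and
          e: "\<And>y. \<bar>y - u\<bar> < e \<Longrightarrow> (F has_real_derivative 2 powr of_int (k u)) (at y)"
          using deriv[OF u] by blast
        have "2 powr real_of_int (k u) = 2 powr real_of_int (k v)"
          if "v \<in> {a<..<b}" "\<bar>v - u\<bar> < e" for v
        proof -
          show ?thesis by (rule DERIV_unique[OF e[OF that(2)] deriv_at[OF that(1)]])
        qed
        then show "\<forall>\<^sub>F v in at u within {a<..<b}. 2 powr real_of_int (k u) = 2 powr real_of_int (k v)"
          unfolding eventually_at using \<open>e > 0\<close> by (intro exI[of _ e]) (auto simp: dist_real_def)
      qed
    qed (use x c in auto)
    \<comment> \<open>The derivative of this difference vanishes inside the cell; continuity extends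
      the affine formula to the ends.\<close>
    let ?g = "\<lambda>x. F x - 2 powr of_int (k c) * (x - a)"
    have "?g x = ?g a" if x: "x \<in> {a..b}" for x
    proof (rule DERIV_isconst2[OF \<open>a < b\<close>])
      show "continuous_on {a..b} ?g"
        using F by (auto simp: thompson_lift_def intro!: continuous_intros intro: continuous_on_subset)
      fix y assume "a < y" "y < b"
      then have y: "y \<in> {a<..<b}" by simp
      have "(F has_real_derivative 2 powr of_int (k c)) (at y)"
        using deriv_at[OF y] const[OF y] by simp
      then show "(?g has_real_derivative 0) (at y)"
        by (auto intro!: derivative_eq_intros)
    qed (use x in auto)
    then have "\<forall>x\<in>{a..b}. F x = F a + 2 powr of_int (k c) * (x - a)" by fastforce
    then show ?thesis unfolding a_def b_def by blast
  qed
  then show ?thesis using that by blast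
qed

text \<open>A dyadic point of large denominator lies strictly inside a cell, together with its two
  neighbours up to the ends. If the slope there is \<open>2^k\<close>, the denominator exponent
  drops by exactly \<open>k\<close>, and neighbours go to neighbours. Thus the interval of radius
  \<open>2^-d\<close> about the point is mapped onto the one of radius \<open>2^-d'\<close> about
  its image.\<close>

lemma thompson_lift_odd_dyadic:
  assumes F: "thompson_lift F"
  obtains M where "\<And>d j. d > M \<Longrightarrow> odd j \<Longrightarrow> \<exists>d' j'. odd j' \<and>
    F (of_int j / 2 ^ d) = of_int j' / 2 ^ d' \<and>
    F (of_int (j - 1) / 2 ^ d) = of_int (j' - 1) / 2 ^ d' \<and>
    F (of_int (j + 1) / 2 ^ d) = of_int (j' + 1) / 2 ^ d'"
proof -
  note dF = thompson_lift_degree_one[OF F]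
  obtain N where N: "\<And>i::int. \<exists>k::int. \<forall>x\<in>{of_int i / 2 ^ N..of_int (i + 1) / 2 ^ N}.
    F x = F (of_int i / 2 ^ N) + 2 powr of_int k * (x - of_int i / 2 ^ N)"
    using thompson_lift_affine_on_cells[OF F] by blast
  then obtain k :: "int \<Rightarrow> int" where k: "\<And>i x. x \<in> {of_int i / 2 ^ N..of_int (i + 1) / 2 ^ N} \<Longrightarrow>
    F x = F (of_int i / 2 ^ N) + 2 powr of_int (k i) * (x - of_int i / 2 ^ N)"
    by metis
  have fin: "finite {0..<2 ^ N :: int}" by simp
  obtain M where M: "\<And>b. b \<in> (\<lambda>i. F (of_int i / 2 ^ N)) ` {0..<2 ^ N :: int} \<Longrightarrow> \<exists>m::int. b = of_int m / 2 ^ M"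
    by (rule common_dyadic_denominator[of "(\<lambda>i. F (of_int i / 2 ^ N)) ` {0..<2 ^ N :: int}"])
       (use fin in \<open>auto simp: thompson_lift_dyadic[OF F] dyadic_div_power\<close>)
  \<comment> \<open>A crude common bound for the slope exponents over one period of cells.\<close>
  define K where "K = (\<Sum>i\<in>{0..<2 ^ N :: int}. nat \<bar>k i\<bar>)"
  have K: "nat \<bar>k i\<bar> \<le> K" if "i \<in> {0..<2 ^ N}" for i
    unfolding K_def by (rule member_le_sum[OF that]) auto
  show ?thesis
  \<comment> \<open>\<open>d > N\<close> puts the point off the cell ends; the margin
    \<open>M + K\<close> ensures that the new exponent \<open>d - k r\<close> still exceeds
    \<open>M\<close>.\<close>
  proof (rule that[of "N + M + K"])
    fix d :: nat and j :: int
    assume d: "d > N + M + K" and j: "odd j"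
    \<comment> \<open>The point lies in cell \<open>i\<close>, which is the cell \<open>r\<close> of
      \<open>[0, 1)\<close> translated by the integer \<open>q\<close>.\<close>
    define i where "i = j div 2 ^ (d - N)"
    define r where "r = i mod 2 ^ N"
    define q where "q = i div 2 ^ N"
    have r: "r \<in> {0..<2 ^ N}" by (simp add: r_def)
    have iqr: "i = q * 2 ^ N + r" by (simp only: q_def r_def div_mult_mod_eq)
    have i_div: "real_of_int i / 2 ^ N = of_int r / 2 ^ N + of_int q"
      by (simp add: iqr field_simps)
    obtain m :: int where m: "F (of_int r / 2 ^ N) = of_int m / 2 ^ M"
      using M r by blast
    define d' where "d' = nat (int d - k r)"
    have kr: "nat \<bar>k r\<bar> \<le> K" by (rule K[OF r])
    then have d': "int d' = int d - k r" "d' > M" using d by (auto simp: d'_def)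
    have pow_d': "2 powr of_int (k r) / 2 ^ d = 1 / (2::real) ^ d'"
    proof -
      have "real_of_int (k r) = real d - real d'" using d'(1) by linarith
      then show ?thesis by (simp add: powr_diff powr_realpow)
    qed
    have split: "(2::real) ^ d = 2 ^ N * 2 ^ (d - N)" "(2::real) ^ d' = 2 ^ M * 2 ^ (d' - M)"
      using d d' by (simp_all flip: power_add)
    have cell_end: "real_of_int l / 2 ^ N = of_int (l * 2 ^ (d - N)) / 2 ^ d" for l
      by (simp add: split)
    have cell: "F x = of_int m / 2 ^ M + of_int q + 2 powr of_int (k r) * (x - of_int i / 2 ^ N)"
      if x: "x \<in> {of_int i / 2 ^ N..of_int (i + 1) / 2 ^ N}" for x
    proof -
      have "x - of_int q \<in> {of_int r / 2 ^ N..of_int (r + 1) / 2 ^ N}"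
        using x by (simp add: iqr field_simps)
      from k[OF this] m show ?thesis
        by (simp add: degree_one_diff_int[OF dF] i_div algebra_simps)
    qed
    define j' where "j' = m * 2 ^ (d' - M) + q * 2 ^ d' + j - i * 2 ^ (d - N)"
    have val: "F (of_int (j + t) / 2 ^ d) = of_int (j' + t) / 2 ^ d'" if t: "t \<in> {-1, 0, 1}" for t
    proof -
      let ?x = "real_of_int (j + t) / 2 ^ d"
      have j_div: "j = i * 2 ^ (d - N) + j mod 2 ^ (d - N)" by (simp only: i_def div_mult_mod_eq)
      \<comment> \<open>An odd \<open>j\<close> is no multiple of \<open>2^(d - N)\<close>, so a
        shift by one unit cannot leave the closed cell.\<close>
      have "j mod 2 ^ (d - N) \<noteq> 0"
      proof
        assume "j mod 2 ^ (d - N) = 0"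
        then have "2 ^ (d - N) dvd j" by auto
        moreover have "(2::int) dvd 2 ^ (d - N)" using d by simp
        ultimately show False using j dvd_trans by blast
      qed
      moreover have "0 \<le> j mod 2 ^ (d - N)" "j mod 2 ^ (d - N) < 2 ^ (d - N)" by simp_all
      ultimately have bounds: "i * 2 ^ (d - N) \<le> j + t" "j + t \<le> (i + 1) * 2 ^ (d - N)"
        using t j_div unfolding distrib_right by (elim insertE emptyE; linarith)+
      have "real_of_int (i * 2 ^ (d - N)) \<le> of_int (j + t)" "of_int (j + t) \<le> real_of_int ((i + 1) * 2 ^ (d - N))"
        using bounds by (simp_all only: of_int_le_iff)
      then have "?x \<in> {of_int i / 2 ^ N..of_int (i + 1) / 2 ^ N}"
        unfolding atLeastAtMost_iff cell_end by (intro conjI divide_right_mono) simp_all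
      then have "F ?x = of_int m / 2 ^ M + of_int q + 2 powr of_int (k r) * (?x - of_int i / 2 ^ N)"
        by (rule cell)
      also have "?x - of_int i / 2 ^ N = of_int (j + t - i * 2 ^ (d - N)) / 2 ^ d"
        by (simp add: split diff_divide_distrib)
      also have "2 powr of_int (k r) * (real_of_int (j + t - i * 2 ^ (d - N)) / 2 ^ d) =
          real_of_int (j + t - i * 2 ^ (d - N)) * (2 powr of_int (k r) / 2 ^ d)"
        by simp
      also have "\<dots> = of_int (j + t - i * 2 ^ (d - N)) / 2 ^ d'"
        by (simp only: pow_d') simp
      also have "of_int m / 2 ^ M + of_int q + \<dots> = of_int (j' + t) / 2 ^ d'"
        by (simp add: j'_def split add_divide_distrib diff_divide_distrib)
      finally show ?thesis .
    qed
    \<comment> \<open>All terms of \<open>j'\<close> other than \<open>j\<close> are even, since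
      \<open>d' > M\<close> and \<open>d > N\<close>.\<close>
    have "odd j'" using j d d' by (auto simp: j'_def)
    then show "\<exists>d' j'. odd j' \<and>
      F (of_int j / 2 ^ d) = of_int j' / 2 ^ d' \<and>
      F (of_int (j - 1) / 2 ^ d) = of_int (j' - 1) / 2 ^ d' \<and>
      F (of_int (j + 1) / 2 ^ d) = of_int (j' + 1) / 2 ^ d'"
      using val[of 0] val[of 1] val[of "-1"] by (intro exI[of _ d'] exI[of _ j']) simp
  qed
qed

text \<open>The least denominator exponent forces an odd numerator, and it exceeds \<open>M\<close>
  since \<open>x\<close> is off the grid of mesh \<open>2^-M\<close>.\<close>

lemma dyadic_odd_numerator:
  assumes "dyadic x" "\<nexists>m::int. x = of_int m / 2 ^ M"
  obtains j :: int and d where "odd j" "d > M" "x = of_int j / 2 ^ d"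
proof -
  define d where "d = (LEAST d. \<exists>m::int. x = of_int m / 2 ^ d)"
  have ex: "\<exists>d. \<exists>m::int. x = of_int m / 2 ^ d" using assms(1) by (auto simp: dyadic_def)
  from LeastI_ex[OF ex] obtain j :: int where j: "x = of_int j / 2 ^ d" by (auto simp: d_def)
  have "d > M"
  proof (rule ccontr)
    assume "\<not> d > M"
    then have "(2::real) ^ M = 2 ^ d * 2 ^ (M - d)" by (simp flip: power_add)
    then have "x = of_int (j * 2 ^ (M - d)) / 2 ^ M" using j by simp
    with assms(2) show False by blast
  qed
  moreover have "odd j"
  proof
    assume "even j"
    then obtain i where "j = 2 * i" by blast
    then have "x = of_int i / 2 ^ (d - 1)"
      using j \<open>d > M\<close> by (cases d) auto
    then have "d \<le> d - 1" unfolding d_def by (intro Least_le) blast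
    with \<open>d > M\<close> show False by simp
  qed
  ultimately show ?thesis using that j by blast
qed

text \<open>A lift that is affine on the cells of mesh \<open>2^-N\<close> is determined by its
  dyadic values at the finitely many grid points of \<open>[0, 1]\<close>.\<close>

lemma countable_thompson_T_set: "countable thompson_T_set"
proof -
  define A where "A N = {F. thompson_lift F \<and> (\<forall>i::int. \<exists>k::int. \<forall>x\<in>{of_int i / 2 ^ N..of_int (i + 1) / 2 ^ N}.
    F x = F (of_int i / 2 ^ N) + 2 powr of_int k * (x - of_int i / 2 ^ N))}" for N
  \<comment> \<open>The right end \<open>1\<close> is included, so that both ends of the last cell
    are recorded.\<close>
  define enc where "enc N F = map (\<lambda>i. F (real i / 2 ^ N)) [0..<Suc (2 ^ N)]" for N and F :: "real \<Rightarrow> real"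
  have "Collect dyadic \<subseteq> (\<Union>m::int. \<Union>n. {of_int m / 2 ^ n})"
    by (auto simp: dyadic_def)
  then have dyad: "countable (Collect dyadic)" by (rule countable_subset) simp
  have "countable (A N)" for N
  proof (rule countable_image_inj_on)
    have "enc N ` A N \<subseteq> lists (Collect dyadic)"
    proof (rule image_subsetI)
      fix F assume "F \<in> A N"
      then have "thompson_lift F" by (simp add: A_def)
      then have "dyadic (F (real i / 2 ^ N))" for i
        using dyadic_div_power[of "int i" N] by (simp add: thompson_lift_dyadic)
      then show "enc N F \<in> lists (Collect dyadic)" by (auto simp: enc_def in_lists_conv_set simp del: upt_Suc)
    qed
    then show "countable (enc N ` A N)"
      by (rule countable_subset) (rule countable_lists[OF dyad])
    show "inj_on (enc N) (A N)"
    proof (rule inj_onI, rule ext)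
      fix F G and x :: real assume FG: "F \<in> A N" "G \<in> A N" and eq: "enc N F = enc N G"
      have grid: "F (real i / 2 ^ N) = G (real i / 2 ^ N)" if "i \<le> 2 ^ N" for i
        using eq that unfolding enc_def map_eq_conv by (auto simp del: upt_Suc)
      define i where "i = nat \<lfloor>frac x * 2 ^ N\<rfloor>"
      have "0 \<le> frac x * 2 ^ N" by simp
      then have i: "real i = of_int \<lfloor>frac x * 2 ^ N\<rfloor>" unfolding i_def by simp
      have "frac x * 2 ^ N < 1 * 2 ^ N" by (intro mult_strict_right_mono frac_lt_1) simp
      then have "real i < 2 ^ N" unfolding i by linarith
      then have "i < 2 ^ N" by (metis of_nat_less_iff of_nat_numeral of_nat_power)
      then have ends: "F (real i / 2 ^ N) = G (real i / 2 ^ N)"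
        "F (real (Suc i) / 2 ^ N) = G (real (Suc i) / 2 ^ N)" by (intro grid; simp)+
      have cell: "frac x \<in> {real i / 2 ^ N..real (Suc i) / 2 ^ N}"
      proof -
        have "real i \<le> frac x * 2 ^ N" "frac x * 2 ^ N \<le> real (Suc i)" unfolding of_nat_Suc i by linarith+
        then show ?thesis by (simp add: field_simps)
      qed
      \<comment> \<open>The slope on a cell is recovered from the values at its two ends.\<close>
      have interp: "K (frac x) = K (real i / 2 ^ N) +
          (K (real (Suc i) / 2 ^ N) - K (real i / 2 ^ N)) * 2 ^ N * (frac x - real i / 2 ^ N)"
        if "K \<in> A N" for K
      proof -
        have "\<exists>k::int. \<forall>y\<in>{of_int (int i) / 2 ^ N..of_int (int i + 1) / 2 ^ N}.
          K y = K (of_int (int i) / 2 ^ N) + 2 powr of_int k * (y - of_int (int i) / 2 ^ N)"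
          using that unfolding A_def by blast
        then obtain k :: int where k': "\<forall>y\<in>{of_int (int i) / 2 ^ N..of_int (int i + 1) / 2 ^ N}.
          K y = K (of_int (int i) / 2 ^ N) + 2 powr of_int k * (y - of_int (int i) / 2 ^ N)" ..
        have k: "K y = K (real i / 2 ^ N) + 2 powr of_int k * (y - real i / 2 ^ N)"
          if "y \<in> {real i / 2 ^ N..real (Suc i) / 2 ^ N}" for y
          using bspec[OF k', of y] that by (simp add: add.commute)
        have "K (real (Suc i) / 2 ^ N) = K (real i / 2 ^ N) + 2 powr of_int k / 2 ^ N"
          by (subst k) (auto simp: field_simps)
        then show ?thesis using k[OF cell] by simp
      qed
      have "F (frac x) = G (frac x)"
        using interp[OF FG(1)] interp[OF FG(2)] ends by simp
      moreover have shift: "K (frac x) = K x - of_int \<lfloor>x\<rfloor>" if "K \<in> A N" for K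
        using that degree_one_diff_int[OF thompson_lift_degree_one, of K x "\<lfloor>x\<rfloor>"]
        unfolding A_def frac_def by blast
      ultimately show "F x = G x" using shift[OF FG(1)] shift[OF FG(2)] by simp
    qed
  qed
  then have "countable (\<Union>N. A N)" by simp
  moreover have "thompson_T_set \<subseteq> (\<lambda>F x. frac (F x)) ` (\<Union>N. A N)"
  proof
    fix f assume "f \<in> thompson_T_set"
    then obtain F where F: "thompson_lift F" and f: "f = (\<lambda>x. frac (F x))"
      by (auto simp: thompson_T_set_def)
    obtain N where "F \<in> A N"
      using thompson_lift_affine_on_cells[OF F] F unfolding A_def by blast
    then show "f \<in> (\<lambda>F x. frac (F x)) ` (\<Union>N. A N)" using f by blast
  qed
  ultimately show ?thesis by (meson countable_image countable_subset)
qed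

section \<open>Periodic points\<close>

definition contracts :: "(real \<Rightarrow> real) \<Rightarrow> real \<Rightarrow> real \<Rightarrow> bool" where
  "contracts F a b \<longleftrightarrow> (\<lambda>n. (F ^^ n) b - (F ^^ n) a) \<longlonglongrightarrow> 0"

text \<open>Membership in the open set \<open>W\<close> of the proof idea. In
  \<open>contracts\<close> the differences carry no absolute value, so adjacent intervals simply add
  up.\<close>

definition contracted_at :: "(real \<Rightarrow> real) \<Rightarrow> real \<Rightarrow> bool" where
  "contracted_at F x \<longleftrightarrow> (\<exists>e>0. contracts F (x - e) (x + e))"

lemma contracts_mono:
  assumes F: "degree_one F" and "contracts F a b" "a \<le> a'" "a' \<le> b'" "b' \<le> b"
  shows "contracts F a' b'"
  unfolding contracts_def
proof (rule real_tendsto_sandwich[OF _ _ tendsto_const assms(2)[unfolded contracts_def]])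
  note le = degree_one_le_iff[OF degree_one_funpow[OF F]]
  show "\<forall>\<^sub>F n in sequentially. 0 \<le> (F ^^ n) b' - (F ^^ n) a'"
    using assms(4) by (simp add: le)
  have "(F ^^ n) b' - (F ^^ n) a' \<le> (F ^^ n) b - (F ^^ n) a" for n
    using le[of n a a'] le[of n b' b] assms(3,5) by simp
  then show "\<forall>\<^sub>F n in sequentially. (F ^^ n) b' - (F ^^ n) a' \<le> (F ^^ n) b - (F ^^ n) a"
    by simp
qed

lemma contracts_trans: "contracts F a b \<Longrightarrow> contracts F b c \<Longrightarrow> contracts F a c"
  unfolding contracts_def by (drule (1) tendsto_add) simp

lemma contracts_step_iff: "contracts F (F a) (F b) \<longleftrightarrow> contracts F a b"
  unfolding contracts_def
  using filterlim_sequentially_Suc[of "\<lambda>n. (F ^^ n) b - (F ^^ n) a" "nhds 0"] by (simp add: funpow_swap1)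

lemma contracted_at_step_iff:
  assumes F: "degree_one F"
  shows "contracted_at F (F x) \<longleftrightarrow> contracted_at F x"
proof
  assume "contracted_at F (F x)"
  then obtain e where "e > 0" and e: "contracts F (F x - e) (F x + e)"
    by (auto simp: contracted_at_def)
  obtain d where "d > 0" and d: "\<And>y. \<bar>y - x\<bar> < d \<Longrightarrow> \<bar>F y - F x\<bar> < e"
    using degree_one_isCont[OF F, of x] \<open>e > 0\<close>
    unfolding isCont_def LIM_eq by (metis abs_zero diff_self real_norm_def)
  have "contracts F (F (x - d / 2)) (F (x + d / 2))"
    using d[of "x - d / 2"] d[of "x + d / 2"] \<open>d > 0\<close>
    by (intro contracts_mono[OF F e]) (auto simp: abs_less_iff degree_one_le_iff[OF F])
  then show "contracted_at F x"
    unfolding contracted_at_def contracts_step_iff using \<open>d > 0\<close> by (intro exI[of _ "d / 2"]) simp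
next
  assume "contracted_at F x"
  then obtain e where "e > 0" and e: "contracts F (x - e) (x + e)"
    by (auto simp: contracted_at_def)
  define d where "d = min (F x - F (x - e)) (F (x + e) - F x)"
  have "d > 0" using \<open>e > 0\<close> by (simp add: d_def degree_one_less_iff[OF F])
  moreover have "contracts F (F x - d) (F x + d)"
    using \<open>d > 0\<close>
    by (intro contracts_mono[OF F e[folded contracts_step_iff[of F "x - e"]]]) (auto simp: d_def)
  ultimately show "contracted_at F (F x)" by (auto simp: contracted_at_def)
qed

lemma contracted_at_funpow_iff:
  "degree_one F \<Longrightarrow> contracted_at F ((F ^^ n) x) \<longleftrightarrow> contracted_at F x"
  by (induction n) (simp_all add: contracted_at_step_iff)

lemma contracted_at_nearby:
  assumes F: "degree_one F" and "contracted_at F x"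
  obtains e where "e > 0" "\<And>y. \<bar>y - x\<bar> < e \<Longrightarrow> contracted_at F y"
proof -
  obtain e where "e > 0" and e: "contracts F (x - e) (x + e)"
    using assms(2) by (auto simp: contracted_at_def)
  have "contracted_at F y" if "\<bar>y - x\<bar> < e" for y
    unfolding contracted_at_def
  proof (intro exI conjI)
    show "e - \<bar>y - x\<bar> > 0" using that by simp
    show "contracts F (y - (e - \<bar>y - x\<bar>)) (y + (e - \<bar>y - x\<bar>))"
      using that by (intro contracts_mono[OF F e]) auto
  qed
  with \<open>e > 0\<close> show ?thesis using that by blast
qed

lemma contracted_at_add_int:
  assumes F: "degree_one F"
  shows "contracted_at F (x + of_int m) \<longleftrightarrow> contracted_at F x"
proof -
  note shift = degree_one_add_int[OF degree_one_funpow[OF F]]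
  have "contracts F (a + of_int m) (b + of_int m) \<longleftrightarrow> contracts F a b" for a b
    unfolding contracts_def shift by simp
  from this[of "x - e" "x + e" for e] show ?thesis
    unfolding contracted_at_def by (simp add: algebra_simps)
qed

text \<open>The pigeonhole principle for grid points modulo \<open>1\<close>; it serves both for
  orbits of points and for disjoint images of an interval.\<close>

lemma finite_mod_inj:
  fixes g :: "nat \<Rightarrow> int"
  assumes "M > 0" and "\<And>n n'. n \<in> A \<Longrightarrow> n' \<in> A \<Longrightarrow> n < n' \<Longrightarrow> g n mod M \<noteq> g n' mod M"
  shows "finite A"
proof (rule finite_imageD)
  show "finite ((\<lambda>n. g n mod M) ` A)"
    by (rule finite_subset[of _ "{0..<M}"]) (use assms(1) in auto)
  show "inj_on (\<lambda>n. g n mod M) A"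
    by (rule linorder_inj_onI) (use assms(2) in auto)
qed

section \<open>Orbits of dyadic points in the absence of periodic points\<close>

lemma int_mod_power2_eqE:
  assumes "i mod 2 ^ N = (j::int) mod 2 ^ N"
  obtains m :: int where "real_of_int j / 2 ^ N = of_int i / 2 ^ N + of_int m"
proof -
  have "2 ^ N dvd j - i" using assms[symmetric] by (simp only: mod_eq_dvd_iff)
  then obtain m where "j = i + 2 ^ N * m" by (metis add.commute diff_add_cancel dvdE)
  then show ?thesis by (intro that[of m]) (simp add: field_simps)
qed

text \<open>Modulo \<open>1\<close> the grid has \<open>2^N\<close> points, and a second visit to
  one of them would produce a periodic point.\<close>

lemma eventually_leaves_grid:
  assumes F: "degree_one F"
    and np: "\<And>k x (m::int). k > 0 \<Longrightarrow> (F ^^ k) x \<noteq> x + of_int m"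
  shows "\<forall>\<^sub>F n in sequentially. \<nexists>m::int. (F ^^ n) y = of_int m / 2 ^ N"
proof -
  \<comment> \<open>The floor is exact at the times in \<open>A\<close>, the only ones at which it
    is used.\<close>
  define g where "g n = \<lfloor>(F ^^ n) y * 2 ^ N\<rfloor>" for n
  define A where "A = {n. \<exists>m::int. (F ^^ n) y = of_int m / 2 ^ N}"
  have g: "(F ^^ n) y = of_int (g n) / 2 ^ N" if "n \<in> A" for n
    using that by (auto simp: g_def A_def)
  have "finite A"
  proof (rule finite_mod_inj[where M = "2 ^ N" and g = g])
    fix n n' assume A: "n \<in> A" "n' \<in> A" and "n < n'"
    show "g n mod 2 ^ N \<noteq> g n' mod 2 ^ N"
    proof
      assume "g n mod 2 ^ N = g n' mod 2 ^ N"
      then obtain m :: int where "of_int (g n') / 2 ^ N = of_int (g n) / 2 ^ N + real_of_int m"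
        by (rule int_mod_power2_eqE)
      then have "(F ^^ n') y = (F ^^ n) y + of_int m" using g A by simp
      moreover have "(F ^^ n') y = (F ^^ (n' - n)) ((F ^^ n) y)"
        using \<open>n < n'\<close> by (simp flip: funpow_add comp_apply[of "F ^^ (n' - n)"])
      ultimately show False using np[of "n' - n" "(F ^^ n) y" m] \<open>n < n'\<close> by simp
    qed
  qed simp
  then show ?thesis
    by (simp add: A_def eventually_cofinite flip: cofinite_eq_sequentially)
qed

text \<open>Past its last visit to the grid of mesh \<open>2^-M\<close> the orbit obeys
  \<open>thompson_lift_odd_dyadic\<close> at every step, so the interval between the two neighbours
  keeps the form \<open>[(j-1)/2^d, (j+1)/2^d]\<close>. Its length tends to \<open>0\<close> because
  the orbit leaves every grid.\<close>

lemma dyadic_contracted_at: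
  assumes TF: "thompson_lift F" and "dyadic y"
    and np: "\<And>k x (m::int). k > 0 \<Longrightarrow> (F ^^ k) x \<noteq> x + of_int m"
  shows "contracted_at F y"
proof -
  note F = thompson_lift_degree_one[OF TF]
  have dy: "dyadic ((F ^^ n) y)" for n
    using thompson_lift_dyadic[OF thompson_lift_funpow[OF TF]] assms(2) by simp
  obtain M where M: "\<And>d j. d > M \<Longrightarrow> odd j \<Longrightarrow> \<exists>d' j'. odd j' \<and>
    F (of_int j / 2 ^ d) = of_int j' / 2 ^ d' \<and>
    F (of_int (j - 1) / 2 ^ d) = of_int (j' - 1) / 2 ^ d' \<and>
    F (of_int (j + 1) / 2 ^ d) = of_int (j' + 1) / 2 ^ d'"
    using thompson_lift_odd_dyadic[OF TF] by blast
  obtain n0 where n0: "\<And>n. n \<ge> n0 \<Longrightarrow> \<nexists>m::int. (F ^^ n) y = of_int m / 2 ^ M"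
    using eventually_leaves_grid[OF F np, of y M] unfolding eventually_sequentially by blast
  define z where "z = (F ^^ n0) y"
  have zn: "(F ^^ n) z = (F ^^ (n + n0)) y" for n by (simp add: z_def funpow_add)
  \<comment> \<open>A point off the grid of mesh \<open>2^-m\<close> has a larger exponent in every
    representation, reduced or not.\<close>
  have big: "d > m" if "real_of_int j / 2 ^ d = x" "\<nexists>i::int. x = of_int i / 2 ^ m" for d m x and j :: int
  proof (rule ccontr)
    assume "\<not> d > m"
    then have "(2::real) ^ m = 2 ^ d * 2 ^ (m - d)" by (simp flip: power_add)
    then have "x = of_int (j * 2 ^ (m - d)) / 2 ^ m" using that(1) by auto
    with that(2) show False by blast
  qed
  obtain j0 :: int and d0 where j0: "odd j0" "d0 > M" "z = of_int j0 / 2 ^ d0"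
    using dyadic_odd_numerator[OF dy[of n0] n0[OF order_refl]] by (auto simp: z_def)
  have iter: "\<exists>d j. odd j \<and> d > M \<and> (F ^^ n) z = of_int j / 2 ^ d \<and>
      (F ^^ n) (of_int (j0 - 1) / 2 ^ d0) = of_int (j - 1) / 2 ^ d \<and>
      (F ^^ n) (of_int (j0 + 1) / 2 ^ d0) = of_int (j + 1) / 2 ^ d" for n
  proof (induction n)
    case 0
    show ?case using j0 by auto
  next
    case (Suc n)
    then obtain d j where IH: "odd j" "d > M" "(F ^^ n) z = of_int j / 2 ^ d"
      "(F ^^ n) (of_int (j0 - 1) / 2 ^ d0) = of_int (j - 1) / 2 ^ d"
      "(F ^^ n) (of_int (j0 + 1) / 2 ^ d0) = of_int (j + 1) / 2 ^ d" by blast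
    obtain d' j' where j': "odd j'"
      "F (of_int j / 2 ^ d) = of_int j' / 2 ^ d'"
      "F (of_int (j - 1) / 2 ^ d) = of_int (j' - 1) / 2 ^ d'"
      "F (of_int (j + 1) / 2 ^ d) = of_int (j' + 1) / 2 ^ d'"
      using M[OF IH(2,1)] by blast
    have "d' > M"
      using big[of j' d' "(F ^^ Suc n) z" M] n0[of "Suc n + n0"] IH(3) j'(2)
      unfolding zn[symmetric] by simp
    with IH j' show ?case by (intro exI[of _ d'] exI[of _ j']) simp
  qed
  have "contracts F (of_int (j0 - 1) / 2 ^ d0) (of_int (j0 + 1) / 2 ^ d0)"
    unfolding contracts_def
  proof (rule LIMSEQ_I)
    fix r :: real assume "r > 0"
    obtain m where m: "2 / 2 ^ m < r"
      using real_arch_pow_inv[of "r / 2" "1 / 2"] \<open>r > 0\<close> by (auto simp: power_divide field_simps)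
    obtain n1 where n1: "\<And>n. n \<ge> n1 \<Longrightarrow> \<nexists>i::int. (F ^^ n) z = of_int i / 2 ^ m"
      using eventually_leaves_grid[OF F np, of z m] unfolding eventually_sequentially by blast
    have "norm ((F ^^ n) (of_int (j0 + 1) / 2 ^ d0) - (F ^^ n) (of_int (j0 - 1) / 2 ^ d0) - 0) < r"
      if n: "n \<ge> n1" for n
    proof -
      obtain d j where dj: "(F ^^ n) z = of_int j / 2 ^ d"
        "(F ^^ n) (of_int (j0 - 1) / 2 ^ d0) = of_int (j - 1) / 2 ^ d"
        "(F ^^ n) (of_int (j0 + 1) / 2 ^ d0) = of_int (j + 1) / 2 ^ d" using iter[of n] by blast
      have "d > m" using big[OF dj(1)[symmetric] n1[OF n]] .
      then have "2 / 2 ^ d \<le> 2 / (2::real) ^ m" by (intro divide_left_mono power_increasing) auto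
      moreover have "(F ^^ n) (of_int (j0 + 1) / 2 ^ d0) - (F ^^ n) (of_int (j0 - 1) / 2 ^ d0) = 2 / 2 ^ d"
        unfolding dj by (simp flip: diff_divide_distrib)
      ultimately show ?thesis using m by simp
    qed
    then show "\<exists>no. \<forall>n\<ge>no. norm ((F ^^ n) (of_int (j0 + 1) / 2 ^ d0) -
        (F ^^ n) (of_int (j0 - 1) / 2 ^ d0) - 0) < r" by blast
  qed
  moreover have "real_of_int (j0 - 1) / 2 ^ d0 = z - 1 / 2 ^ d0" "real_of_int (j0 + 1) / 2 ^ d0 = z + 1 / 2 ^ d0"
    by (simp_all add: j0(3) add_divide_distrib diff_divide_distrib)
  ultimately have "contracts F (z - 1 / 2 ^ d0) (z + 1 / 2 ^ d0)" by simp
  then have "contracted_at F z"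
    unfolding contracted_at_def by (intro exI[of _ "1 / 2 ^ d0"]) simp
  then show ?thesis by (simp add: z_def contracted_at_funpow_iff[OF F])
qed

text \<open>Grid points have contracted neighbourhoods of a uniform radius \<open>e\<close>. A point
  that is not contracted therefore has distance at least \<open>e\<close> from the ends of its cell,
  and \<open>F\<close> is affine on its \<open>e\<close>-neighbourhood.\<close>

lemma thompson_lift_symmetric_away_from_grid:
  assumes TF: "thompson_lift F"
    and dyad: "\<And>y. dyadic y \<Longrightarrow> contracted_at F y"
  obtains e where "e > 0" "\<And>z h. \<not> contracted_at F z \<Longrightarrow> 0 \<le> h \<Longrightarrow> h < e \<Longrightarrow> F (z + h) - F z = F z - F (z - h)"
proof -
  note F = thompson_lift_degree_one[OF TF]
  obtain N where N: "\<And>i::int. \<exists>k::int. \<forall>x\<in>{of_int i / 2 ^ N..of_int (i + 1) / 2 ^ N}.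
    F x = F (of_int i / 2 ^ N) + 2 powr of_int k * (x - of_int i / 2 ^ N)"
    using thompson_lift_affine_on_cells[OF TF] by blast
  \<comment> \<open>The finitely many grid points in one period have a common radius; translation by
    integers then covers all others.\<close>
  have "\<forall>\<^sub>F e in at_right 0. \<forall>i\<in>{0..<2 ^ N :: int}. \<forall>x. \<bar>x - of_int i / 2 ^ N\<bar> < e \<longrightarrow> contracted_at F x"
  proof (rule eventually_ball_finite, simp, rule ballI)
    fix i :: int
    obtain e where "e > 0" and e: "\<And>y. \<bar>y - of_int i / 2 ^ N\<bar> < e \<Longrightarrow> contracted_at F y"
      using contracted_at_nearby[OF F dyad[OF dyadic_div_power]] by blast
    show "\<forall>\<^sub>F e in at_right 0. \<forall>x. \<bar>x - of_int i / 2 ^ N\<bar> < e \<longrightarrow> contracted_at F x"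
      unfolding eventually_at_right_field using \<open>e > 0\<close> e by (intro exI[of _ e]) auto
  qed
  then obtain b where b: "b > 0" "\<And>e i x. 0 < e \<Longrightarrow> e < b \<Longrightarrow> i \<in> {0..<2 ^ N :: int} \<Longrightarrow>
      \<bar>x - of_int i / 2 ^ N\<bar> < e \<Longrightarrow> contracted_at F x"
    unfolding eventually_at_right_field by blast
  define e where "e = b / 2"
  have "e > 0" using b(1) by (simp add: e_def)
  have near: "contracted_at F x" if x: "\<bar>x - of_int i / 2 ^ N\<bar> < e" for i :: int and x
  proof -
    have i: "i = (i div 2 ^ N) * 2 ^ N + i mod 2 ^ N" by (simp only: div_mult_mod_eq)
    have "real_of_int i / 2 ^ N = of_int (i mod 2 ^ N) / 2 ^ N + of_int (i div 2 ^ N)"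
      by (subst i) (simp add: add_divide_distrib)
    then have "contracted_at F (x + of_int (- (i div 2 ^ N)))"
      using x b(2)[of e "i mod 2 ^ N" "x + of_int (- (i div 2 ^ N))"] \<open>e > 0\<close>
      by (simp add: e_def algebra_simps)
    then show ?thesis unfolding contracted_at_add_int[OF F] .
  qed
  show ?thesis
  proof (rule that[OF \<open>e > 0\<close>])
    fix z h assume z: "\<not> contracted_at F z" and h: "0 \<le> h" "h < e"
    define i where "i = \<lfloor>z * 2 ^ N\<rfloor>"
    obtain k :: int where k: "\<And>x. x \<in> {of_int i / 2 ^ N..of_int (i + 1) / 2 ^ N} \<Longrightarrow>
      F x = F (of_int i / 2 ^ N) + 2 powr of_int k * (x - of_int i / 2 ^ N)"
      using N[of i] by blast
    have "of_int i / 2 ^ N \<le> z" "z \<le> of_int (i + 1) / 2 ^ N"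
      unfolding i_def by (simp_all add: pos_divide_le_eq pos_le_divide_eq)
    moreover have "\<not> \<bar>z - of_int i / 2 ^ N\<bar> < e" "\<not> \<bar>z - of_int (i + 1) / 2 ^ N\<bar> < e"
      using near[of z i] near[of z "i + 1"] z by blast+
    ultimately have "z - h \<in> {of_int i / 2 ^ N..of_int (i + 1) / 2 ^ N}"
      "z \<in> {of_int i / 2 ^ N..of_int (i + 1) / 2 ^ N}"
      "z + h \<in> {of_int i / 2 ^ N..of_int (i + 1) / 2 ^ N}"
      using h unfolding atLeastAtMost_iff by linarith+
    from this[THEN k] show "F (z + h) - F z = F z - F (z - h)" by (simp only:) (simp add: algebra_simps)
  qed
qed

text \<open>Compactness of \<open>[a, b]\<close> by bisection: contraction is additive over adjacent
  intervals and holds for all short intervals around each point.\<close>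

lemma contracts_if_contracted_at:
  assumes F: "degree_one F" and "a \<le> b" "\<And>x. a \<le> x \<Longrightarrow> x \<le> b \<Longrightarrow> contracted_at F x"
  shows "contracts F a b"
  using assms(2)
proof (rule Bolzano)
  fix x assume "a \<le> x" "x \<le> b"
  then obtain e where "e > 0" and e: "contracts F (x - e) (x + e)"
    using assms(3) unfolding contracted_at_def by blast
  show "\<exists>d>0. \<forall>a b. a \<le> x \<and> x \<le> b \<and> b - a < d \<longrightarrow> contracts F a b"
    using \<open>e > 0\<close> contracts_mono[OF F e] by (intro exI[of _ e]) auto
qed (rule contracts_trans)

section \<open>Existence of periodic points\<close>

lemma thompson_lift_periodic_point:
  assumes TF: "thompson_lift F"
  shows "\<exists>k>0. \<exists>x. \<exists>m::int. (F ^^ k) x = x + of_int m"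
proof (rule ccontr)
  assume "\<not> ?thesis"
  then have np: "(F ^^ k) x \<noteq> x + of_int m" if "k > 0" for k x and m :: int
    using that by blast
  note F = thompson_lift_degree_one[OF TF]
  note Fn = degree_one_funpow[OF F]
  have dyad: "contracted_at F y" if "dyadic y" for y
    using dyadic_contracted_at[OF TF that np] .
  \<comment> \<open>The points of \<open>[0, \<infinity>)\<close> outside \<open>W\<close>. If there
    were none, \<open>[0, 1]\<close> would contract, yet its images have length \<open>1\<close>. As
    \<open>W\<close> is open and contains \<open>0\<close>, the infimum is positive and lies outside
    \<open>W\<close>.\<close>
  define Z where "Z = {z. 0 \<le> z \<and> \<not> contracted_at F z}"
  have "Z \<noteq> {}"
  proof
    assume "Z = {}"
    then have "contracts F 0 1" by (intro contracts_if_contracted_at[OF F]) (auto simp: Z_def)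
    moreover have "(F ^^ n) 1 - (F ^^ n) 0 = 1" for n
      using degree_one_add_int[OF Fn, of n 0 1] by simp
    ultimately show False by (simp add: contracts_def LIMSEQ_const_iff)
  qed
  define a where "a = Inf Z"
  have bdd: "bdd_below Z" by (rule bdd_belowI[of _ 0]) (simp add: Z_def)
  have below: "contracted_at F x" if "0 \<le> x" "x < a" for x
    using cInf_lower[OF _ bdd, of x] that by (force simp: a_def Z_def)
  have "0 \<le> a" unfolding a_def by (rule cInf_greatest[OF \<open>Z \<noteq> {}\<close>]) (simp add: Z_def)
  have a: "\<not> contracted_at F a"
  proof
    assume "contracted_at F a"
    then obtain e where "e > 0" and e: "\<And>y. \<bar>y - a\<bar> < e \<Longrightarrow> contracted_at F y"
      using contracted_at_nearby[OF F] by blast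
    obtain z where "z \<in> Z" "z < a + e"
      using cInf_lessD[OF \<open>Z \<noteq> {}\<close>, of "a + e"] \<open>e > 0\<close> by (auto simp: a_def)
    moreover from \<open>z \<in> Z\<close> have "a \<le> z" unfolding a_def by (rule cInf_lower[OF _ bdd])
    ultimately show False using e[of z] by (auto simp: Z_def)
  qed
  have an: "\<not> contracted_at F ((F ^^ n) a + of_int m)" for n and m :: int
    using a by (simp add: contracted_at_add_int[OF F] contracted_at_funpow_iff[OF F])
  have "a \<noteq> 0" using dyad[OF dyadic_of_int[of 0]] a by auto
  with \<open>0 \<le> a\<close> have "a > 0" by simp
  \<comment> \<open>The images of \<open>[0, a)\<close> are disjoint modulo \<open>1\<close>. If one
    met a translate, compare the ends \<open>a\<close> and \<open>c\<close>, both outside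
    \<open>W\<close>: they differ since \<open>a\<close> is not periodic, and the smaller one would
    lie inside the other interval, hence in \<open>W\<close>.\<close>
  have wander: "(F ^^ k) x \<noteq> y + of_int m"
    if "k > 0" and x: "0 \<le> x" "x < a" and y: "0 \<le> y" "y < a" for k x y and m :: int
  proof
    assume eq: "(F ^^ k) x = y + of_int m"
    define c where "c = (F ^^ k) a + of_int (- m)"
    have nc: "\<not> contracted_at F c" unfolding c_def by (rule an)
    have "y < c" using x(2) eq degree_one_less_iff[OF Fn, of k x a] by (simp add: c_def)
    have "c \<noteq> a" using np[OF \<open>k > 0\<close>, of a m] by (auto simp: c_def)
    moreover have "\<not> c < a" using below[of c] nc \<open>y < c\<close> y(1) by auto
    ultimately have "a < c" by simp
    obtain w where w: "(F ^^ k) w = a + of_int m" using degree_one_surj[OF Fn] by blast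
    have "(F ^^ k) x < (F ^^ k) w" using eq w y(2) by simp
    then have "x < w" by (simp add: degree_one_less_iff[OF Fn])
    have "(F ^^ k) w < (F ^^ k) a" using w \<open>a < c\<close> by (simp add: c_def)
    then have "w < a" by (simp add: degree_one_less_iff[OF Fn])
    have "contracted_at F w" using below[of w] \<open>x < w\<close> x(1) \<open>w < a\<close> by simp
    then have "contracted_at F (a + of_int m)"
      unfolding w[symmetric] by (simp add: contracted_at_funpow_iff[OF F])
    with a show False by (simp add: contracted_at_add_int[OF F])
  qed
  \<comment> \<open>Every image of length at least \<open>2^-N\<close> contains a point of the grid
    of mesh \<open>2^-N\<close>; disjointness modulo \<open>1\<close> leaves room for finitely many
    such images.\<close>
  have lim: "contracts F 0 a"
    unfolding contracts_def
  proof (rule LIMSEQ_I)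
    fix r :: real assume "r > 0"
    obtain N where N: "1 / 2 ^ N < r"
      using real_arch_pow_inv[of r "1 / 2"] \<open>r > 0\<close> by (auto simp: power_divide)
    define A where "A = {n. 1 / 2 ^ N \<le> (F ^^ n) a - (F ^^ n) 0}"
    \<comment> \<open>The first grid point not to the left of \<open>F^n 0\<close>; the ceiling
      keeps it inside the half-open image of \<open>[0, a)\<close>.\<close>
    define g where "g n = \<lceil>(F ^^ n) 0 * 2 ^ N\<rceil>" for n
    have g: "\<exists>x. 0 \<le> x \<and> x < a \<and> (F ^^ n) x = of_int (g n) / 2 ^ N" if "n \<in> A" for n
    proof -
      obtain x where x: "(F ^^ n) x = of_int (g n) / 2 ^ N" using degree_one_surj[OF Fn] by blast
      have "(F ^^ n) 0 * 2 ^ N \<le> g n" "g n < (F ^^ n) 0 * 2 ^ N + 1" unfolding g_def by linarith+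
      then have "(F ^^ n) 0 \<le> (F ^^ n) x" "(F ^^ n) x < (F ^^ n) 0 + 1 / 2 ^ N"
        by (simp_all add: x field_simps)
      moreover have "(F ^^ n) 0 + 1 / 2 ^ N \<le> (F ^^ n) a" using that by (simp add: A_def)
      ultimately have "(F ^^ n) 0 \<le> (F ^^ n) x" "(F ^^ n) x < (F ^^ n) a" by linarith+
      then have "0 \<le> x" "x < a"
        unfolding degree_one_le_iff[OF Fn] degree_one_less_iff[OF Fn] .
      with x show ?thesis by blast
    qed
    have "finite A"
    proof (rule finite_mod_inj[where M = "2 ^ N" and g = g])
      fix n n' assume A: "n \<in> A" "n' \<in> A" and "n < n'"
      show "g n mod 2 ^ N \<noteq> g n' mod 2 ^ N"
      proof
        assume "g n mod 2 ^ N = g n' mod 2 ^ N"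
        then obtain m :: int where m: "of_int (g n') / 2 ^ N = of_int (g n) / 2 ^ N + real_of_int m"
          by (rule int_mod_power2_eqE)
        obtain x where x: "0 \<le> x" "x < a" "(F ^^ n) x = of_int (g n) / 2 ^ N" using g A(1) by blast
        obtain x' where x': "0 \<le> x'" "x' < a" "(F ^^ n') x' = of_int (g n') / 2 ^ N" using g A(2) by blast
        have "(F ^^ n') x' = (F ^^ n) (x + of_int m)"
          using m x(3) x'(3) by (simp add: degree_one_add_int[OF Fn])
        moreover have "(F ^^ n') x' = (F ^^ n) ((F ^^ (n' - n)) x')"
          using \<open>n < n'\<close> by (simp flip: funpow_add comp_apply[of "F ^^ n"])
        ultimately have "(F ^^ (n' - n)) x' = x + of_int m" by (simp add: degree_one_eq_iff[OF Fn])
        with wander[of "n' - n" x' x m] x x' \<open>n < n'\<close> show False by simp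
      qed
    qed simp
    then have "\<forall>\<^sub>F n in sequentially. n \<notin> A"
      by (simp add: eventually_cofinite flip: cofinite_eq_sequentially)
    then obtain n0 where n0: "\<And>n. n \<ge> n0 \<Longrightarrow> n \<notin> A" unfolding eventually_sequentially by blast
    have "norm ((F ^^ n) a - (F ^^ n) 0 - 0) < r" if "n \<ge> n0" for n
    proof -
      have "(F ^^ n) 0 < (F ^^ n) a" using \<open>a > 0\<close> by (simp add: degree_one_less_iff[OF Fn])
      then show ?thesis using n0[OF that] N by (simp add: A_def)
    qed
    then show "\<exists>no. \<forall>n\<ge>no. norm ((F ^^ n) a - (F ^^ n) 0 - 0) < r" by blast
  qed
  obtain e where "e > 0" and
    e: "\<And>z h. \<not> contracted_at F z \<Longrightarrow> 0 \<le> h \<Longrightarrow> h < e \<Longrightarrow> F (z + h) - F z = F z - F (z - h)"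
    using thompson_lift_symmetric_away_from_grid[OF TF dyad] by blast
  obtain n0 where n0: "\<And>n. n \<ge> n0 \<Longrightarrow> \<bar>(F ^^ n) a - (F ^^ n) 0\<bar> < e"
    using LIMSEQ_D[OF lim[unfolded contracts_def] \<open>e > 0\<close>] by auto
  define a' l where "a' = (F ^^ n0) a" and "l = (F ^^ n0) a - (F ^^ n0) 0"
  have "l > 0" using \<open>a > 0\<close> by (simp add: l_def degree_one_less_iff[OF Fn])
  have al: "a' - l = (F ^^ n0) 0" by (simp add: a'_def l_def)
  have shift: "(F ^^ n) ((F ^^ n0) x) = (F ^^ (n + n0)) x" for n x by (simp add: funpow_add)
  \<comment> \<open>The reflected interval to the right of \<open>a'\<close> keeps the length of the
    left one: no iterate of \<open>a'\<close> is in \<open>W\<close> and the lengths stay below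
    \<open>e\<close>, so \<open>F\<close> is affine at that scale.\<close>
  have sym: "(F ^^ n) (a' + l) - (F ^^ n) a' = (F ^^ n) a' - (F ^^ n) (a' - l)" for n
  proof (induction n)
    case (Suc n)
    define z h where "z = (F ^^ n) a'" and "h = (F ^^ n) a' - (F ^^ n) (a' - l)"
    have "\<not> contracted_at F z" using an[of "n + n0" 0] by (simp add: z_def a'_def shift)
    moreover have "0 \<le> h" using \<open>l > 0\<close> by (simp add: h_def degree_one_le_iff[OF Fn])
    moreover have "h < e" using n0[of "n + n0"] unfolding h_def al unfolding a'_def shift by simp
    ultimately have "F (z + h) - F z = F z - F (z - h)" by (rule e)
    moreover have "(F ^^ n) (a' + l) = z + h" using Suc by (simp add: z_def h_def)
    ultimately show ?case by (simp add: z_def h_def)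
  qed simp
  have "contracts F (a' - l) a'"
    using lim LIMSEQ_ignore_initial_segment[of "\<lambda>n. (F ^^ n) a - (F ^^ n) 0" 0 n0]
    unfolding al contracts_def by (simp add: a'_def shift)
  moreover from this have "contracts F a' (a' + l)" unfolding contracts_def sym .
  ultimately have "contracts F (a' - l) (a' + l)" by (rule contracts_trans)
  then have "contracted_at F a'" using \<open>l > 0\<close> unfolding contracted_at_def by blast
  then show False using an[of n0 0] by (simp add: a'_def)
qed

section \<open>Wandering intervals\<close>

lemma funpow_mult_periodic_point:
  assumes F: "degree_one F" and x: "(F ^^ q) x = x + of_int p"
  shows "(F ^^ (r + q * t)) x = (F ^^ r) x + of_int (int t * p)"
proof (induction t)
  case (Suc t)
  have "(F ^^ (r + q * Suc t)) x = (F ^^ (r + q * t)) ((F ^^ q) x)"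
    by (simp add: algebra_simps flip: funpow_add comp_apply[of "F ^^ (r + q * t)"])
  also have "\<dots> = (F ^^ (r + q * t)) x + of_int p"
    by (simp add: x degree_one_add_int[OF degree_one_funpow[OF F]])
  finally show ?case using Suc by (simp add: algebra_simps)
qed simp

text \<open>\<open>F 0\<close> lies strictly between consecutive integers \<open>n\<close> and
  \<open>n + 1\<close>. By continuity a short interval to the right of \<open>0\<close> is mapped
  below \<open>n + 1\<close>, and above its own translate by \<open>n\<close>.\<close>

lemma small_interval_avoids_translates:
  assumes F: "degree_one F" and "F 0 \<notin> \<int>"
  shows "\<forall>\<^sub>F d in at_right 0. \<forall>x y. \<forall>m::int. 0 < x \<and> x < d \<and> 0 < y \<and> y < d \<longrightarrow> F x \<noteq> y + of_int m"
proof -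
  define n where "n = \<lfloor>F 0\<rfloor>"
  have n: "of_int n < F 0" "F 0 < of_int n + 1"
    using assms(2) unfolding n_def by (metis Ints_of_int floor_correct order_le_less, linarith)
  define c where "c = of_int n + 1 - F 0"
  obtain d where "d > 0" and d: "\<And>x. 0 < x \<Longrightarrow> x < d \<Longrightarrow> F x < F 0 + c"
  proof -
    have "\<forall>\<^sub>F x in at_right 0. F x < F 0 + c"
    proof (rule order_tendstoD(2))
      show "(F \<longlongrightarrow> F 0) (at_right 0)"
        using degree_one_isCont[OF F, of 0] by (simp add: isCont_def filterlim_at_split)
    qed (use n in \<open>simp add: c_def\<close>)
    then show ?thesis using that unfolding eventually_at_right_field by blast
  qed
  have "F x \<noteq> y + of_int m"
    if e: "e < min d (F 0 - of_int n)" and x: "0 < x" "x < e" and y: "0 < y" "y < e" for e x y and m :: int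
  proof
    assume eq: "F x = y + of_int m"
    have "F 0 < F x" using x by (simp add: degree_one_less_iff[OF F])
    then have "of_int n < real_of_int m" using eq e y by simp
    moreover have "F x < of_int n + 1" using d[of x] x e by (simp add: c_def)
    then have "real_of_int m < of_int (n + 1)" using eq y by simp
    ultimately show False unfolding of_int_less_iff by linarith
  qed
  moreover have "min d (F 0 - of_int n) > 0" using \<open>d > 0\<close> n by simp
  ultimately show ?thesis unfolding eventually_at_right_field by blast
qed

text \<open>The conclusion says that a power returning a point to the interval is the identity on
  the circle. If \<open>F^q\<close> is a translation for the minimal period \<open>q\<close>, a
  short interval at \<open>0\<close> works. Otherwise the interval between \<open>c\<close> and
  \<open>G c\<close> works, where \<open>G\<close> lifts the \<open>q\<close>-th power, has a fixed
  point and moves \<open>c\<close>.\<close>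

lemma periodic_lift_wandering_interval:
  assumes F: "degree_one F" and "k0 > 0" "(F ^^ k0) x0 = x0 + of_int (m0::int)"
  obtains u v where "u < v"
    "\<And>k x y (m::int). u < x \<Longrightarrow> x < v \<Longrightarrow> u < y \<Longrightarrow> y < v \<Longrightarrow> (F ^^ k) x = y + of_int m \<Longrightarrow>
       \<forall>z. \<exists>i::int. (F ^^ k) z = z + of_int i"
proof -
  note Fn = degree_one_funpow[OF F]
  define P where "P k \<longleftrightarrow> k > 0 \<and> (\<exists>x. \<exists>m::int. (F ^^ k) x = x + of_int m)" for k
  define q where "q = (LEAST k. P k)"
  have "P k0" using assms by (auto simp: P_def)
  then have "P q" unfolding q_def by (rule LeastI)
  then obtain b and p :: int where "q > 0" and b: "(F ^^ q) b = b + of_int p" by (auto simp: P_def)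
  have min: "(F ^^ r) x \<noteq> x + of_int m" if "0 < r" "r < q" for r x and m :: int
    using not_less_Least[of r P] that by (auto simp: P_def q_def)
  show ?thesis
  proof (cases "\<forall>x. (F ^^ q) x = x + of_int p")
    case True
    \<comment> \<open>By minimality of \<open>q\<close>, no \<open>F^r\<close> with
      \<open>0 < r < q\<close> maps \<open>0\<close> to an integer.\<close>
    have "\<forall>\<^sub>F d in at_right 0. \<forall>r\<in>{1..<q}. \<forall>x y. \<forall>m::int. 0 < x \<and> x < d \<and> 0 < y \<and> y < d \<longrightarrow>
        (F ^^ r) x \<noteq> y + of_int m"
    proof (rule eventually_ball_finite, simp, rule ballI)
      fix r assume "r \<in> {1..<q}"
      then have "(F ^^ r) 0 \<notin> \<int>" using min[of r 0] by (auto elim!: Ints_cases)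
      then show "\<forall>\<^sub>F d in at_right 0. \<forall>x y. \<forall>m::int. 0 < x \<and> x < d \<and> 0 < y \<and> y < d \<longrightarrow>
          (F ^^ r) x \<noteq> y + of_int m"
        by (rule small_interval_avoids_translates[OF Fn])
    qed
    then obtain c where c: "c > 0" "\<And>d r x y (m::int). 0 < d \<Longrightarrow> d < c \<Longrightarrow> r \<in> {1..<q} \<Longrightarrow>
        0 < x \<Longrightarrow> x < d \<Longrightarrow> 0 < y \<Longrightarrow> y < d \<Longrightarrow> (F ^^ r) x \<noteq> y + of_int m"
      unfolding eventually_at_right_field by blast
    show ?thesis
    proof (rule that[of 0 "c / 2"])
      show "0 < c / 2" using c(1) by simp
      fix k x y and m :: int
      assume xy: "0 < x" "x < c / 2" "0 < y" "y < c / 2" and eq: "(F ^^ k) x = y + of_int m"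
      define r t where "r = k mod q" and "t = k div q"
      have k: "k = r + q * t" by (simp add: r_def t_def)
      have Fk: "(F ^^ k) z = (F ^^ r) z + of_int (int t * p)" for z
        unfolding k by (rule funpow_mult_periodic_point[OF F]) (use True in blast)
      have "r = 0"
      proof (rule ccontr)
        assume "r \<noteq> 0"
        then have "r \<in> {1..<q}" using \<open>q > 0\<close> by (auto simp: r_def Suc_le_eq)
        moreover have "(F ^^ r) x = y + of_int (m - int t * p)" using eq Fk[of x] by simp
        ultimately show False using c(2)[of "c / 2" r x y "m - int t * p"] c(1) xy by simp
      qed
      then show "\<forall>z. \<exists>i::int. (F ^^ k) z = z + of_int i" using Fk by (metis funpow_0)
    qed
  next
    case False
    then obtain c where c: "(F ^^ q) c \<noteq> c + of_int p" by blast
    define G where "G x = (F ^^ q) x - of_int p" for x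
    have Gb: "G b = b" using b by (simp add: G_def)
    have Gc: "G c \<noteq> c" using c by (simp add: G_def)
    have G_less: "G x < G y \<longleftrightarrow> x < y" and G_le: "G x \<le> G y \<longleftrightarrow> x \<le> y" for x y
      by (simp_all add: G_def degree_one_less_iff[OF Fn] degree_one_le_iff[OF Fn])
    have G_int: "G (x + of_int m) = G x + of_int m" for x and m :: int
      by (simp add: G_def degree_one_add_int[OF Fn])
    \<comment> \<open>The supremum \<open>a\<close> turns out to be the greatest fixed point of
      \<open>G\<close> at or below \<open>c\<close>; \<open>Q\<close> is nonempty because integer
      translates of \<open>b\<close> are fixed too.\<close>
    define Q where "Q = {x. x \<le> c \<and> G x = x}"
    define a where "a = Sup Q"
    have "b + of_int (\<lfloor>c - b\<rfloor>) \<in> Q" unfolding Q_def by (simp add: G_int Gb) linarith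
    then have "Q \<noteq> {}" by blast
    have bdd: "bdd_above Q" by (rule bdd_aboveI[of _ c]) (simp add: Q_def)
    have "a \<le> G a" unfolding a_def
    proof (rule cSup_least[OF \<open>Q \<noteq> {}\<close>])
      fix w assume w: "w \<in> Q"
      then have "G w \<le> G (Sup Q)" by (simp add: G_le cSup_upper[OF _ bdd])
      with w show "w \<le> G (Sup Q)" by (simp add: Q_def)
    qed
    moreover have "\<not> a < G a"
    proof
      assume "a < G a"
      obtain a' where "(F ^^ q) a' = a + of_int p" using degree_one_surj[OF Fn] by blast
      then have a': "G a' = a" by (simp add: G_def)
      with \<open>a < G a\<close> have "a' < Sup Q" using G_less[of a' a] by (simp add: a_def)
      then obtain w where w: "w \<in> Q" "a' < w" using less_cSupE[OF _ \<open>Q \<noteq> {}\<close>] by blast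
      then have "a < w" using G_less[of a' w] a' by (simp add: Q_def)
      moreover have "w \<le> a" unfolding a_def by (rule cSup_upper[OF w(1) bdd])
      ultimately show False by simp
    qed
    moreover have "a \<le> c" unfolding a_def by (rule cSup_least[OF \<open>Q \<noteq> {}\<close>]) (simp add: Q_def)
    ultimately have "a \<in> Q" by (simp add: Q_def)
    then have Ga: "G a = a" and "a < c" using Gc by (auto simp: Q_def order_le_less)
    have "a < G c" using \<open>a < c\<close> G_less[of a c] Ga by simp
    define u v where "u = min c (G c)" and "v = max c (G c)"
    have "u < v" using Gc by (auto simp: u_def v_def)
    have "a < u" using \<open>a < c\<close> \<open>a < G c\<close> by (simp add: u_def)
    \<comment> \<open>A fixed point beyond \<open>c\<close> is also beyond \<open>G c\<close>, so
      all fixed points below \<open>v\<close> lie in \<open>Q\<close>.\<close>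
    have fixed_le: "w \<le> a" if "G w = w" "w < v" for w
    proof -
      have "w \<le> c"
      proof (rule ccontr)
        assume "\<not> w \<le> c"
        then have "G c < w" using G_less[of c w] that(1) by simp
        with \<open>\<not> w \<le> c\<close> that(2) show False by (simp add: v_def)
      qed
      then have "w \<in> Q" using that(1) by (simp add: Q_def)
      then show ?thesis unfolding a_def by (rule cSup_upper[OF _ bdd])
    qed
    show ?thesis
    proof (rule that[OF \<open>u < v\<close>])
      fix k x y and m :: int
      assume x: "u < x" "x < v" and y: "u < y" "y < v" and eq: "(F ^^ k) x = y + of_int m"
      define H where "H x = (F ^^ k) x - of_int m" for x
      have Hx: "H x = y" using eq by (simp add: H_def)
      have H_less: "H x < H y \<longleftrightarrow> x < y" and H_le: "H x \<le> H y \<longleftrightarrow> x \<le> y"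
        and H_eq: "H x = H y \<longleftrightarrow> x = y" for x y
        by (simp_all add: H_def degree_one_less_iff[OF Fn] degree_one_le_iff[OF Fn] degree_one_eq_iff[OF Fn])
      \<comment> \<open>The return map \<open>H\<close> commutes with \<open>G\<close> and hence
        permutes its fixed points. Both \<open>H a\<close> and the \<open>H\<close>-preimage of
        \<open>a\<close> are below \<open>v\<close>, so \<open>fixed_le\<close> bounds them by
        \<open>a\<close>, and \<open>H\<close> fixes \<open>a\<close>.\<close>
      have HG: "H (G z) = G (H z)" for z
        by (simp add: H_def G_def degree_one_diff_int[OF Fn] add.commute
            flip: funpow_add comp_apply[of "F ^^ k"] comp_apply[of "F ^^ q"])
      have "H a \<le> a"
      proof (rule fixed_le)
        show "G (H a) = H a" by (simp add: Ga flip: HG)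
        have "H a < H x" using \<open>a < u\<close> x by (simp add: H_less)
        then show "H a < v" using Hx y by simp
      qed
      moreover have "a \<le> H a"
      proof -
        obtain w where "(F ^^ k) w = a + of_int m" using degree_one_surj[OF Fn] by blast
        then have w: "H w = a" by (simp add: H_def)
        have "H (G w) = H w" by (simp add: HG w Ga)
        then have "G w = w" by (simp add: H_eq)
        have "H w < H x" using w Hx \<open>a < u\<close> y by simp
        then have "w < v" using x by (simp add: H_less)
        with \<open>G w = w\<close> have "w \<le> a" by (rule fixed_le)
        then show ?thesis using H_le[of w a] w by simp
      qed
      ultimately have Ha: "(F ^^ k) a = a + of_int m" by (simp add: H_def)
      define r t where "r = k mod q" and "t = k div q"
      have k: "k = r + q * t" by (simp add: r_def t_def)
      \<comment> \<open>As \<open>a\<close> has minimal period \<open>q\<close> as well,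
        \<open>k\<close> is a multiple \<open>q * t\<close> and \<open>m = t * p\<close>, that is,
        \<open>H\<close> is the \<open>t\<close>-th power of \<open>G\<close>.\<close>
      have "(F ^^ q) a = a + of_int p" using Ga by (simp add: G_def)
      from funpow_mult_periodic_point[OF F this, of r t] Ha
      have Fra: "(F ^^ r) a = a + of_int (m - int t * p)" by (simp add: k)
      have "r < q" using \<open>q > 0\<close> by (simp add: r_def)
      then have "r = 0" using min[of r a "m - int t * p"] Fra by blast
      with Fra have "real_of_int (m - int t * p) = 0" by (simp del: of_int_diff of_int_mult)
      then have m: "m = int t * p" unfolding of_int_eq_0_iff by simp
      have kt: "k = q * t" using k \<open>r = 0\<close> by simp
      have "t = 0"
      proof (rule ccontr)
        assume "t \<noteq> 0"
        then obtain s where s: "t = Suc s" by (cases t) auto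
        have step: "(F ^^ (q * Suc (Suc n))) c = (F ^^ q) ((F ^^ (q * Suc n)) c)" for n
          by (simp add: algebra_simps flip: funpow_add comp_apply[of "F ^^ q"])
        show False
        \<comment> \<open>Powers of \<open>G\<close> move \<open>c\<close> monotonically, and one
          step already reaches the other end of the interval. So a positive power carries the
          interval past that end, and no return is possible.\<close>
        proof (cases "c < G c")
          case True
          have "(F ^^ (q * Suc n)) c \<ge> G c + of_int (int (Suc n) * p)" for n
          proof (induction n)
            case (Suc n)
            have "c + of_int (int (Suc (Suc n)) * p - p) \<le> (F ^^ (q * Suc n)) c"
              using Suc True by (simp add: algebra_simps)
            then have "(F ^^ q) (c + of_int (int (Suc (Suc n)) * p - p)) \<le> (F ^^ (q * Suc (Suc n))) c"
              unfolding step by (simp only: degree_one_le_iff[OF Fn])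
            then show ?case unfolding degree_one_add_int[OF Fn] by (simp add: G_def algebra_simps)
          qed (simp add: G_def)
          from this[of s] have "G c + of_int m \<le> (F ^^ k) c" by (simp only: s[symmetric] kt m)
          also have "\<dots> < (F ^^ k) x" using x True by (simp add: u_def degree_one_less_iff[OF Fn])
          finally show False using eq y True by (simp add: v_def)
        next
          case False
          have "(F ^^ (q * Suc n)) c \<le> G c + of_int (int (Suc n) * p)" for n
          proof (induction n)
            case (Suc n)
            have "(F ^^ (q * Suc n)) c \<le> c + of_int (int (Suc (Suc n)) * p - p)"
              using Suc False by (simp add: algebra_simps)
            then have "(F ^^ (q * Suc (Suc n))) c \<le> (F ^^ q) (c + of_int (int (Suc (Suc n)) * p - p))"
              unfolding step by (simp only: degree_one_le_iff[OF Fn])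
            then show ?case unfolding degree_one_add_int[OF Fn] by (simp add: G_def algebra_simps)
          qed (simp add: G_def)
          from this[of s] have "(F ^^ k) c \<le> G c + of_int m" by (simp only: s[symmetric] kt m)
          moreover have "(F ^^ k) x < (F ^^ k) c" using x False by (simp add: v_def degree_one_less_iff[OF Fn])
          ultimately show False using eq y False by (simp add: u_def)
        qed
      qed
      then show "\<forall>z. \<exists>i::int. (F ^^ k) z = z + of_int i"
        using kt by (auto intro: exI[of _ 0])
    qed
  qed
qed

section \<open>Squeezing the complement of an interval into another interval\<close>

lemma thompson_lift_translation:
  assumes "dyadic r"
  shows "thompson_lift (\<lambda>x. x + r)"
proof -
  have "pow2_affine_at (\<lambda>x. x + r) x" for x
    unfolding pow2_affine_at_def by (rule exI[of _ 0], rule exI[of _ 1]) simp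
  moreover have "degree_one (\<lambda>x. x + r)"
    by (auto simp: degree_one_def strict_mono_def intro!: continuous_intros)
  ultimately show ?thesis
    unfolding thompson_lift_iff using assms by (auto simp: dyadic_add_iff)
qed

lemma dyadic_double_iff: "dyadic (2 * x) \<longleftrightarrow> dyadic x"
proof
  assume "dyadic (2 * x)"
  then obtain m :: int and n where "2 * x = of_int m / 2 ^ n" by (auto simp: dyadic_def)
  then have "x = of_int m / 2 ^ Suc n" by simp
  then show "dyadic x" unfolding dyadic_def by blast
qed (use dyadic_add[of x x] in simp)

lemma pow2_affine_atI:
  assumes "a < x" "x < b" "\<And>y. a < y \<Longrightarrow> y < b \<Longrightarrow> F y = 2 powr real_of_int k * y + c"
  shows "pow2_affine_at F x"
  unfolding pow2_affine_at_def
proof (intro exI conjI allI impI)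
  show "min (x - a) (b - x) > 0" using assms by simp
  fix y assume "\<bar>y - x\<bar> < min (x - a) (b - x)"
  then show "F y = F x + 2 powr real_of_int k * (y - x)"
    using assms(1,2) assms(3)[of x] assms(3)[of y] by (auto simp: algebra_simps)
qed

section \<open>A dyadic map pushing the open unit interval towards its right end\<close>

text \<open>On \<open>[0, 1]\<close> this is the standard generator \<open>x\<^sub>0\<close> of Thompson's group \<open>F\<close>, with slopes
  \<open>2\<close>, \<open>1\<close> and \<open>1/2\<close>; its only fixed points are the end points.\<close>

definition push :: "real \<Rightarrow> real" where
  "push x = x + min (frac x) (min (1 / 4) ((1 - frac x) / 2))"

lemma push_cases:
  "push x = of_int \<lfloor>x\<rfloor> + 2 * frac x \<and> frac x \<le> 1 / 4 \<or>
   push x = of_int \<lfloor>x\<rfloor> + frac x + 1 / 4 \<and> 1 / 4 \<le> frac x \<and> frac x \<le> 1 / 2 \<or>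
   push x = of_int \<lfloor>x\<rfloor> + (frac x + 1) / 2 \<and> 1 / 2 \<le> frac x"
proof -
  have "x = of_int \<lfloor>x\<rfloor> + frac x" by (simp add: frac_def)
  then show ?thesis unfolding push_def min_def by (auto simp: field_simps)
qed

text \<open>All slopes lie between \<open>1/2\<close> and \<open>2\<close>; the two bounds yield
  strict monotonicity and continuity.\<close>

lemma push_bilipschitz:
  assumes "x \<le> y"
  shows "(y - x) / 2 \<le> push y - push x \<and> push y - push x \<le> 2 * (y - x)"
proof -
  define s t i j where "s = frac x" and "t = frac y"
    and "i = real_of_int \<lfloor>x\<rfloor>" and "j = real_of_int \<lfloor>y\<rfloor>"
  have st: "0 \<le> s" "s < 1" "0 \<le> t" "t < 1" by (simp_all add: s_def t_def frac_lt_1)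
  have x: "x = i + s" "y = j + t" by (simp_all add: s_def t_def i_def j_def frac_def)
  have "\<lfloor>x\<rfloor> = \<lfloor>y\<rfloor> \<or> \<lfloor>x\<rfloor> + 1 \<le> \<lfloor>y\<rfloor>"
    using floor_mono[OF assms] by linarith
  then have "i = j \<or> i + 1 \<le> j" unfolding i_def j_def by (elim disjE) linarith+
  then show ?thesis
    using assms st push_cases[of x] push_cases[of y]
    unfolding s_def[symmetric] t_def[symmetric] i_def[symmetric] j_def[symmetric]
    unfolding x by argo
qed

lemma thompson_lift_push: "thompson_lift push"
proof -
  have "strict_mono push"
  proof (rule strict_monoI)
    fix x y :: real assume "x < y"
    then show "push x < push y" using push_bilipschitz[of x y] by simp
  qed
  moreover have "push (x + 1) = push x + 1" for x
    by (simp add: push_def frac_1_eq)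
  moreover have "continuous_on UNIV push"
  proof (intro continuous_at_imp_continuous_on ballI, unfold isCont_def, rule LIM_I)
    fix x e :: real assume "e > 0"
    have "\<bar>push y - push x\<bar> < e" if "\<bar>y - x\<bar> < e / 2" for y
      using push_bilipschitz[of x y] push_bilipschitz[of y x] that by (cases "x \<le> y") auto
    then show "\<exists>d>0. \<forall>y. y \<noteq> x \<and> norm (y - x) < d \<longrightarrow> norm (push y - push x) < e"
      using \<open>e > 0\<close> by (intro exI[of _ "e / 2"]) auto
  qed
  ultimately have "degree_one push" by (simp add: degree_one_def)
  moreover have "dyadic x \<longleftrightarrow> dyadic (push x)" for x
  proof -
    consider "push x = 2 * x + of_int (- \<lfloor>x\<rfloor>)" | "push x = x + of_int 1 / 2 ^ 2"
      | "2 * push x = x + of_int (\<lfloor>x\<rfloor> + 1)"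
      using push_cases[of x] unfolding frac_def by (auto simp: field_simps)
    then show ?thesis
      by cases (metis dyadic_double_iff dyadic_add_iff[OF dyadic_of_int] dyadic_add_iff[OF dyadic_div_power])+
  qed
  \<comment> \<open>The breakpoints \<open>0\<close>, \<open>1/2\<close> and \<open>1/4\<close>,
    written so that \<open>dyadic_div_power\<close> applies.\<close>
  moreover have "pow2_affine_at push x" if "frac x \<notin> {of_int 0 / 2 ^ 0, of_int 1 / 2 ^ 1, of_int 1 / 2 ^ 2}" for x
  proof -
    define n where "n = real_of_int \<lfloor>x\<rfloor>"
    have x: "n \<le> x" "x < n + 1" unfolding n_def by linarith+
    have fr: "frac y = y - n" if "n < y" "y < n + 1" for y
      using that unfolding n_def frac_def by (metis floor_unique less_imp_le of_int_eq_iff)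
    have "x \<noteq> n" "x \<noteq> n + 1 / 2" "x \<noteq> n + 1 / 4" using that by (auto simp: n_def frac_def)
    with x consider "n < x" "x < n + 1 / 4" | "n + 1 / 4 < x" "x < n + 1 / 2" | "n + 1 / 2 < x" "x < n + 1"
      by linarith
    then show ?thesis
    proof cases
      case 1
      then show ?thesis
        by (rule pow2_affine_atI[of _ _ _ _ 1 "- n"]) (auto simp: push_def fr min_def)
    next
      case 2
      then show ?thesis
        by (rule pow2_affine_atI[of _ _ _ _ 0 "1 / 4"]) (auto simp: push_def fr min_def)
    next
      case 3
      then show ?thesis
        by (rule pow2_affine_atI[of _ _ _ _ "-1" "(n + 1) / 2"])
          (auto simp: push_def fr min_def powr_minus field_simps)
    qed
  qed
  moreover have "\<forall>b\<in>{of_int 0 / 2 ^ 0, of_int 1 / 2 ^ 1, of_int 1 / 2 ^ 2}. dyadic b"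
    using dyadic_div_power by blast
  ultimately show ?thesis
    unfolding thompson_lift_iff by (metis finite.emptyI finite.insertI)
qed

lemma push_funpow_tends_to_1:
  assumes "0 < w" "0 < d"
  obtains n where "\<And>x. w \<le> x \<Longrightarrow> x < 1 \<Longrightarrow> 1 - d \<le> (push ^^ n) x \<and> (push ^^ n) x < 1"
proof -
  \<comment> \<open>A lower bound for the displacement on \<open>[w, 1 - d]\<close>, one term for
    each branch of \<open>push\<close>. It gives a number of steps that suits all starting points at
    once.\<close>
  define c where "c = min w (min (1 / 4) (d / 2))"
  have "c > 0" using assms by (simp add: c_def)
  have iter: "w \<le> (push ^^ n) x \<and> (push ^^ n) x < 1 \<and> min (1 - d) (real n * c) \<le> (push ^^ n) x"
    if x: "w \<le> x" "x < 1" for n x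
  proof (induction n)
    case 0
    show ?case using x assms by simp
  next
    case (Suc n)
    define t where "t = (push ^^ n) x"
    have t: "w \<le> t" "t < 1" "min (1 - d) (real n * c) \<le> t" using Suc by (simp_all add: t_def)
    have "frac t = t" using t assms by (simp add: frac_eq)
    then have p: "push t = t + min t (min (1 / 4) ((1 - t) / 2))" by (simp add: push_def)
    have "push t < 1" using p t(2) unfolding min_def by (simp add: field_simps split: if_splits)
    moreover have "t \<le> push t" using p t assms by simp
    moreover have "min (1 - d) (real (Suc n) * c) \<le> push t"
    proof (cases "t \<le> 1 - d")
      case True
      then have "c \<le> push t - t" using t p by (auto simp: c_def min_def split: if_splits)
      moreover have "min (1 - d) (real (Suc n) * c) \<le> min (1 - d) (real n * c) + c"
        using \<open>c > 0\<close> by (simp add: algebra_simps min_def)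
      ultimately show ?thesis using t(3) by linarith
    next
      case False
      then show ?thesis using \<open>t \<le> push t\<close> by simp
    qed
    ultimately show ?case using t(1) by (simp add: t_def)
  qed
  obtain n where "1 < real n * c" using reals_Archimedean3[OF \<open>c > 0\<close>] by blast
  then have "min (1 - d) (real n * c) = 1 - d" using assms by simp
  then show ?thesis using iter[of _ n] that by metis
qed

text \<open>Modulo \<open>1\<close>, \<open>[j + w, j + 1)\<close> is the complement of
  \<open>[j, j + w)\<close>. Translate \<open>j\<close> to \<open>0\<close>, push towards
  \<open>1\<close>, and translate \<open>1\<close> to a dyadic \<open>s\<close> near
  \<open>v\<close>.\<close>

lemma thompson_lift_into_interval:
  assumes "u < v" "dyadic j" "0 < w"
  obtains F where "thompson_lift F" "\<And>x. j + w \<le> x \<Longrightarrow> x < j + 1 \<Longrightarrow> u < F x \<and> F x < v"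
proof -
  \<comment> \<open>Half of the length pays for rounding \<open>v\<close> down to the grid point
    \<open>s\<close>, half for the interval \<open>[s - 2^-N, s)\<close> that receives the
    image.\<close>
  obtain N where N: "1 / 2 ^ N < (v - u) / 2"
    using real_arch_pow_inv[of "(v - u) / 2" "1 / 2"] assms(1) by (auto simp: power_divide)
  define s where "s = of_int \<lfloor>v * 2 ^ N\<rfloor> / (2::real) ^ N"
  have "s \<le> v" unfolding s_def by (simp add: pos_divide_le_eq)
  have "v * 2 ^ N < of_int \<lfloor>v * 2 ^ N\<rfloor> + 1" by linarith
  then have "v < s + 1 / 2 ^ N" by (simp add: s_def field_simps)
  obtain n where n: "\<And>x. w \<le> x \<Longrightarrow> x < 1 \<Longrightarrow> 1 - 1 / 2 ^ N \<le> (push ^^ n) x \<and> (push ^^ n) x < 1"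
    using push_funpow_tends_to_1[OF assms(3), of "1 / 2 ^ N"] by auto
  define F where "F = (\<lambda>x. x + (s + of_int (- 1))) \<circ> (push ^^ n) \<circ> (\<lambda>x. x + - j)"
  have "dyadic (s + of_int (- 1))"
    unfolding s_def by (intro dyadic_add dyadic_div_power dyadic_of_int)
  then have "thompson_lift F"
    unfolding F_def using assms(2)
    by (intro thompson_lift_comp thompson_lift_translation thompson_lift_funpow thompson_lift_push dyadic_minus)
  moreover have "u < F x \<and> F x < v" if "j + w \<le> x" "x < j + 1" for x
    using n[of "x - j"] that N \<open>s \<le> v\<close> \<open>v < s + 1 / 2 ^ N\<close> by (simp add: F_def)
  ultimately show ?thesis using that by blast
qed

section \<open>The group and the ping-pong argument\<close>

lemma thompson_T_simps:
  "carrier thompson_T = thompson_T_set" "mult thompson_T = (\<circ>)" "one thompson_T = frac"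
  by (simp_all add: thompson_T_def)

lemma thompson_TI: "thompson_lift F \<Longrightarrow> (\<lambda>x. frac (F x)) \<in> carrier thompson_T"
  by (auto simp: thompson_T_simps thompson_T_set_def)

lemma thompson_TE:
  assumes "f \<in> carrier thompson_T"
  obtains F where "thompson_lift F" "f = (\<lambda>x. frac (F x))"
  using assms by (auto simp: thompson_T_simps thompson_T_set_def)

lemma thompson_T_mult:
  assumes "thompson_lift F"
  shows "(\<lambda>x. frac (F x)) \<otimes>\<^bsub>thompson_T\<^esub> (\<lambda>x. frac (G x)) = (\<lambda>x. frac (F (G x)))"
  using frac_degree_one_frac[OF thompson_lift_degree_one[OF assms]]
  by (auto simp: thompson_T_simps)

lemma group_thompson_T: "group thompson_T"
proof (rule groupI)
  fix f g assume "f \<in> carrier thompson_T" "g \<in> carrier thompson_T"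
  then obtain F G where "thompson_lift F" "f = (\<lambda>x. frac (F x))" "thompson_lift G" "g = (\<lambda>x. frac (G x))"
    by (meson thompson_TE)
  then show "f \<otimes>\<^bsub>thompson_T\<^esub> g \<in> carrier thompson_T"
    using thompson_TI[OF thompson_lift_comp] by (simp add: thompson_T_mult)
next
  have "thompson_lift (\<lambda>x. x + of_int 0)" by (rule thompson_lift_translation[OF dyadic_of_int])
  then show "\<one>\<^bsub>thompson_T\<^esub> \<in> carrier thompson_T"
    using thompson_TI by (fastforce simp: thompson_T_simps)
next
  fix f assume "f \<in> carrier thompson_T"
  then obtain F where F: "thompson_lift F" "f = (\<lambda>x. frac (F x))" by (rule thompson_TE)
  then show "\<one>\<^bsub>thompson_T\<^esub> \<otimes>\<^bsub>thompson_T\<^esub> f = f"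
    by (auto simp: thompson_T_simps)
  obtain G where G: "thompson_lift G" "\<And>x. G (F x) = x"
    using thompson_lift_inverse[OF F(1)] by blast
  then have "(\<lambda>x. frac (G x)) \<otimes>\<^bsub>thompson_T\<^esub> f = \<one>\<^bsub>thompson_T\<^esub>"
    unfolding F(2) thompson_T_mult[OF G(1)] by (simp add: thompson_T_simps)
  then show "\<exists>g\<in>carrier thompson_T. g \<otimes>\<^bsub>thompson_T\<^esub> f = \<one>\<^bsub>thompson_T\<^esub>"
    using thompson_TI[OF G(1)] by blast
qed (auto simp: thompson_T_simps)

interpretation T: group thompson_T
  by (rule group_thompson_T)

text \<open>Group elements are \<open>1\<close>-periodic functions on the line with values in
  \<open>[0, 1)\<close>, so the action on the circle is plain application on
  \<open>{0..<1}\<close>.\<close>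

lemma thompson_T_apply:
  assumes "f \<in> carrier thompson_T"
  shows "f (frac x) = f x" "f x \<in> {0..<1}"
proof -
  obtain F where F: "thompson_lift F" "f = (\<lambda>x. frac (F x))" using assms by (rule thompson_TE)
  show "f (frac x) = f x"
    unfolding F(2) by (rule frac_degree_one_frac[OF thompson_lift_degree_one[OF F(1)]])
  show "f x \<in> {0..<1}" by (simp add: F(2) frac_lt_1)
qed

lemma thompson_T_nat_pow:
  assumes F: "thompson_lift F"
  shows "(\<lambda>x. frac (F x)) [^]\<^bsub>thompson_T\<^esub> (n::nat) = (\<lambda>x. frac ((F ^^ n) x))"
proof (induction n)
  case 0
  show ?case by (simp add: thompson_T_simps)
next
  case (Suc n)
  have "(\<lambda>x. frac ((F ^^ n) x)) \<otimes>\<^bsub>thompson_T\<^esub> (\<lambda>x. frac (F x)) = (\<lambda>x. frac ((F ^^ n) (F x)))"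
    by (rule thompson_T_mult[OF thompson_lift_funpow[OF F]])
  with Suc show ?case by (simp add: funpow_swap1)
qed

lemma thompson_T_wandering_interval:
  assumes s: "s \<in> carrier thompson_T"
  obtains u v where "u < v" "\<And>(k::int) x. x \<in> frac ` {u<..<v} \<Longrightarrow>
    (s [^]\<^bsub>thompson_T\<^esub> k) x \<in> frac ` {u<..<v} \<Longrightarrow> s [^]\<^bsub>thompson_T\<^esub> k = \<one>\<^bsub>thompson_T\<^esub>"
proof -
  obtain F where F: "thompson_lift F" "s = (\<lambda>x. frac (F x))" using s by (rule thompson_TE)
  obtain k0 x0 and m0 :: int where "k0 > 0" "(F ^^ k0) x0 = x0 + of_int m0"
    using thompson_lift_periodic_point[OF F(1)] by blast
  then obtain u v where "u < v" and
    uv: "\<And>k x y (m::int). u < x \<Longrightarrow> x < v \<Longrightarrow> u < y \<Longrightarrow> y < v \<Longrightarrow> (F ^^ k) x = y + of_int m \<Longrightarrow>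
       \<forall>z. \<exists>i::int. (F ^^ k) z = z + of_int i"
    using periodic_lift_wandering_interval[OF thompson_lift_degree_one[OF F(1)]] by metis
  have nat: "s [^]\<^bsub>thompson_T\<^esub> k = \<one>\<^bsub>thompson_T\<^esub>"
    if xy: "x \<in> frac ` {u<..<v}" "(s [^]\<^bsub>thompson_T\<^esub> k) x \<in> frac ` {u<..<v}" for k :: nat and x
  proof -
    obtain a where a: "u < a" "a < v" "x = frac a" using xy(1) by auto
    obtain b where b: "u < b" "b < v" "(s [^]\<^bsub>thompson_T\<^esub> k) x = frac b" using xy(2) by auto
    have "(s [^]\<^bsub>thompson_T\<^esub> k) x = (s [^]\<^bsub>thompson_T\<^esub> k) a"
      unfolding a(3) using s by (intro thompson_T_apply T.nat_pow_closed)
    then have "frac ((F ^^ k) a) = frac b" using b(3) by (simp add: F thompson_T_nat_pow)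
    then obtain m :: int where "(F ^^ k) a = b + of_int m" by (auto simp: frac_eq_frac_iff)
    then have "\<forall>z. \<exists>i::int. (F ^^ k) z = z + of_int i" using uv a b by blast
    then have "frac ((F ^^ k) z) = frac z" for z by (simp add: frac_eq_frac_iff)
    then show ?thesis by (auto simp: F thompson_T_nat_pow thompson_T_simps)
  qed
  have "s [^]\<^bsub>thompson_T\<^esub> k = \<one>\<^bsub>thompson_T\<^esub>"
    if xy: "x \<in> frac ` {u<..<v}" "(s [^]\<^bsub>thompson_T\<^esub> k) x \<in> frac ` {u<..<v}" for k :: int and x
  proof (cases k)
    case (nonneg n)
    then show ?thesis using nat[of x n] xy by (simp add: int_pow_int)
  next
    case (neg n)
    \<comment> \<open>If the inverse of \<open>h\<close> keeps a point of the interval inside, then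
      \<open>h\<close> brings the image back to that point, which reduces negative powers to
      positive ones.\<close>
    define h where "h = s [^]\<^bsub>thompson_T\<^esub> Suc n"
    have h: "h \<in> carrier thompson_T" unfolding h_def using s by (rule T.nat_pow_closed)
    have k: "s [^]\<^bsub>thompson_T\<^esub> k = inv\<^bsub>thompson_T\<^esub> h"
      unfolding neg h_def by (rule T.int_pow_neg_int[OF s])
    have "h ((inv\<^bsub>thompson_T\<^esub> h) x) = (h \<otimes>\<^bsub>thompson_T\<^esub> inv\<^bsub>thompson_T\<^esub> h) x"
      by (simp add: thompson_T_simps)
    also have "\<dots> = frac x" using h by (simp add: thompson_T_simps(3))
    also have "\<dots> = x" using xy(1) by auto
    finally have "h ((inv\<^bsub>thompson_T\<^esub> h) x) \<in> frac ` {u<..<v}" using xy(1) by simp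
    moreover have "(inv\<^bsub>thompson_T\<^esub> h) x \<in> frac ` {u<..<v}" using xy(2) by (simp only: k)
    ultimately have "h = \<one>\<^bsub>thompson_T\<^esub>"
      using nat[of "(inv\<^bsub>thompson_T\<^esub> h) x" "Suc n", folded h_def] by blast
    then show ?thesis by (simp add: k)
  qed
  with \<open>u < v\<close> show ?thesis using that by blast
qed

section \<open>Ping-pong in an abstract group\<close>

lemma (in group) int_pow_conj:
  assumes "s \<in> carrier G" "g \<in> carrier G"
  shows "(inv g \<otimes> s \<otimes> g) [^] (k::int) = inv g \<otimes> s [^] k \<otimes> g"
proof -
  have cancel: "g \<otimes> (inv g \<otimes> x) = x" if "x \<in> carrier G" for x
    using assms(2) that by (simp flip: m_assoc)
  interpret conj: group_hom G G "\<lambda>x. inv g \<otimes> x \<otimes> g"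
    by (unfold_locales, rule homI) (use assms(2) in \<open>auto simp: m_assoc cancel\<close>)
  show ?thesis using conj.hom_int_pow[OF assms(1), of k] by simp
qed

text \<open>A substitute for reduced words: a power of \<open>c s\<close> acts only on points
  outside \<open>J s\<close>, so under the ping-pong hypotheses nontrivial powers of one generator
  never follow each other.\<close>

inductive_set ping_pong_orbit :: "('a, 'm) monoid_scheme \<Rightarrow> ('a \<Rightarrow> 'b \<Rightarrow> 'b) \<Rightarrow> 's set \<Rightarrow> ('s \<Rightarrow> 'a) \<Rightarrow> ('s \<Rightarrow> 'b set) \<Rightarrow> 'b \<Rightarrow> 'b set"
  for G act S c J p where
    base: "p \<in> ping_pong_orbit G act S c J p"
  | step: "x \<in> ping_pong_orbit G act S c J p \<Longrightarrow> s \<in> S \<Longrightarrow> x \<notin> J s \<Longrightarrow>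
      act (c s [^]\<^bsub>G\<^esub> (k::int)) x \<in> ping_pong_orbit G act S c J p"

text \<open>The orbit set visibly stays in \<open>p\<close> and the sets \<open>J s\<close>, so it
  suffices that all generators and their inverses preserve it.\<close>

lemma (in group) ping_pong:
  assumes act_one: "\<And>x. x \<in> X \<Longrightarrow> act \<one> x = x"
    and act_mult: "\<And>g h x. g \<in> carrier G \<Longrightarrow> h \<in> carrier G \<Longrightarrow> x \<in> X \<Longrightarrow> act (g \<otimes> h) x = act g (act h x)"
    and act_closed: "\<And>g x. g \<in> carrier G \<Longrightarrow> x \<in> X \<Longrightarrow> act g x \<in> X"
    and c: "\<And>s. s \<in> S \<Longrightarrow> c s \<in> carrier G"
    and disj: "\<And>s t x. s \<in> S \<Longrightarrow> t \<in> S \<Longrightarrow> x \<in> J s \<Longrightarrow> x \<in> J t \<Longrightarrow> s = t"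
    and ping: "\<And>s (k::int) x. s \<in> S \<Longrightarrow> x \<in> X \<Longrightarrow> x \<notin> J s \<Longrightarrow> c s [^] k \<noteq> \<one> \<Longrightarrow> act (c s [^] k) x \<in> J s"
    and p: "p \<in> X" "\<And>s. s \<in> S \<Longrightarrow> p \<notin> J s"
    and g: "g \<in> generate G (c ` S)"
  shows "act g p = p \<or> (\<exists>s\<in>S. act g p \<in> J s)"
proof -
  let ?Orb = "ping_pong_orbit G act S c J p"
  have X: "x \<in> X" if "x \<in> ?Orb" for x
    using that by induction (auto intro!: p act_closed int_pow_closed c)
  have cover: "x = p \<or> (\<exists>s\<in>S. x \<in> J s)" if "x \<in> ?Orb" for x
    using that
  proof induction
    case (step x s k)
    show ?case
    proof (cases "c s [^] k = \<one>")
      case True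
      then show ?thesis using step.IH act_one[OF X[OF step.hyps(1)]] by simp
    next
      case False
      then show ?thesis using ping[OF step.hyps(2) X[OF step.hyps(1)] step.hyps(3)] step.hyps(2) by blast
    qed
  qed simp
  have closed: "act (c s [^] k) x \<in> ?Orb" if "x \<in> ?Orb" "s \<in> S" for s x and k :: int
    using that(1)
  proof (induction arbitrary: k)
    case base
    show ?case using p(2) that(2) by (intro ping_pong_orbit.intros) auto
  next
    case (step x t l)
    note x = X[OF step.hyps(1)]
    show ?case
    proof (cases "c t [^] l = \<one>")
      case True
      then show ?thesis using step.IH act_one[OF x] by simp
    next
      case False
      then have J: "act (c t [^] l) x \<in> J t" by (rule ping[OF step.hyps(2) x step.hyps(3)])
      show ?thesis
      proof (cases "s = t")
        case True
        \<comment> \<open>Merging the exponents restarts from \<open>x\<close>, which is outside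
          \<open>J t\<close>.\<close>
        have "act (c t [^] k) (act (c t [^] l) x) = act (c t [^] (k + l)) x"
          using c[OF step.hyps(2)] x by (simp add: int_pow_mult act_mult)
        then show ?thesis using True ping_pong_orbit.step[OF step.hyps] by simp
      next
        case False
        then have "act (c t [^] l) x \<notin> J s" using disj[OF that(2) step.hyps(2)] J by blast
        from ping_pong_orbit.step[OF ping_pong_orbit.step[OF step.hyps] that(2) this]
        show ?thesis .
      qed
    qed
  qed
  have sub: "h \<in> carrier G" if "h \<in> generate G (c ` S)" for h
    using generate_in_carrier[OF _ that] c by blast
  have "\<forall>x\<in>?Orb. act g x \<in> ?Orb"
    using g
  proof induction
    case one
    then show ?case using act_one X by simp
  next
    case (incl h)
    then obtain s where "s \<in> S" "h = c s" by blast
    then show ?case using closed[of _ s 1] c by simp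
  next
    case (inv h)
    then obtain s where s: "s \<in> S" "h = c s" by blast
    then show ?case using closed[of _ s "- 1"] c by (simp add: int_pow_neg)
  next
    case (eng h1 h2)
    then show ?case using sub X by (simp add: act_mult)
  qed
  then have "act g p \<in> ?Orb" using ping_pong_orbit.base by (rule bspec)
  then show ?thesis by (rule cover)
qed

section \<open>Disjoint dyadic intervals and an orbit that misses a point\<close>

theorem theorem4p6:
  shows "\<not> invariably_generated thompson_T"
proof
  assume "invariably_generated thompson_T"
  then obtain S where S: "S \<subseteq> carrier thompson_T" and gen: "\<And>g. g \<in> S \<rightarrow> carrier thompson_T \<Longrightarrow>
      generate thompson_T ((\<lambda>s. inv\<^bsub>thompson_T\<^esub> (g s) \<otimes>\<^bsub>thompson_T\<^esub> s \<otimes>\<^bsub>thompson_T\<^esub> g s) ` S) = carrier thompson_T"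
    unfolding invariably_generated_def by blast
  define idx where "idx = to_nat_on thompson_T_set"
  have idx: "inj_on idx S"
    unfolding idx_def using S
    by (auto intro: inj_on_subset[OF inj_on_to_nat_on[OF countable_thompson_T_set]] simp: thompson_T_simps)
  \<comment> \<open>Disjoint intervals below \<open>1/2\<close>, indexed by the enumeration of the
    countable group; \<open>1/2\<close> and \<open>3/4\<close> stay outside all of them.\<close>
  define J where "J s = {1 / 2 ^ (idx s + 2)..<1 / (2::real) ^ (idx s + 1)}" for s
  have "\<exists>g\<in>carrier thompson_T. \<forall>x (k::int). x \<in> {0..<1} - J s \<longrightarrow>
      (inv\<^bsub>thompson_T\<^esub> g \<otimes>\<^bsub>thompson_T\<^esub> s [^]\<^bsub>thompson_T\<^esub> k \<otimes>\<^bsub>thompson_T\<^esub> g) x \<in> {0..<1} - J s \<longrightarrow>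
      s [^]\<^bsub>thompson_T\<^esub> k = \<one>\<^bsub>thompson_T\<^esub>" if "s \<in> S" for s
  proof -
    have s: "s \<in> carrier thompson_T" using S that by blast
    obtain u v where "u < v" and uv: "\<And>(k::int) x. x \<in> frac ` {u<..<v} \<Longrightarrow>
      (s [^]\<^bsub>thompson_T\<^esub> k) x \<in> frac ` {u<..<v} \<Longrightarrow> s [^]\<^bsub>thompson_T\<^esub> k = \<one>\<^bsub>thompson_T\<^esub>"
      using thompson_T_wandering_interval[OF s] by blast
    \<comment> \<open>\<open>j\<close> is both the left end and the length of
      \<open>J s\<close>.\<close>
    define j where "j = 1 / (2::real) ^ (idx s + 2)"
    have "j + j = 1 / 2 ^ (idx s + 1)" by (simp add: j_def)
    then have Js: "J s = {j..<j + j}" by (simp add: J_def j_def)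
    have "(1::real) \<le> 2 ^ (idx s + 1)" by (rule one_le_power) simp
    with \<open>j + j = 1 / 2 ^ (idx s + 1)\<close> have j: "0 < j" "j + j \<le> 1" by (simp_all add: j_def)
    have "dyadic j" unfolding j_def using dyadic_div_power[of 1] by (simp only: of_int_1)
    then obtain F where F: "thompson_lift F" "\<And>x. j + j \<le> x \<Longrightarrow> x < j + 1 \<Longrightarrow> u < F x \<and> F x < v"
      using thompson_lift_into_interval[OF \<open>u < v\<close> _ j(1)] by blast
    define g where "g = (\<lambda>x. frac (F x))"
    have g: "g \<in> carrier thompson_T" unfolding g_def by (rule thompson_TI[OF F(1)])
    have into: "g x \<in> frac ` {u<..<v}" if x: "x \<in> {0..<1} - J s" for x
    proof (cases "j + j \<le> x")
      case True
      then show ?thesis unfolding g_def using F(2)[of x] x j by (intro imageI) auto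
    next
      case False
      then have "x < j" using x by (auto simp: Js)
      \<comment> \<open>Points to the left of \<open>J s\<close> are first moved up by
        \<open>1\<close>, which turns the complement of \<open>J s\<close> into the single interval
        \<open>[2j, j + 1)\<close>.\<close>
      then have "F (x + of_int 1) \<in> {u<..<v}" using F(2)[of "x + of_int 1"] x j by auto
      moreover have "frac (F (x + of_int 1)) = g x"
        unfolding degree_one_add_int[OF thompson_lift_degree_one[OF F(1)]] by (simp only: g_def frac_add_of_int_right)
      ultimately show ?thesis by (metis imageI)
    qed
    have "s [^]\<^bsub>thompson_T\<^esub> k = \<one>\<^bsub>thompson_T\<^esub>"
      if x: "x \<in> {0..<1} - J s" and
        y: "(inv\<^bsub>thompson_T\<^esub> g \<otimes>\<^bsub>thompson_T\<^esub> s [^]\<^bsub>thompson_T\<^esub> k \<otimes>\<^bsub>thompson_T\<^esub> g) x \<in> {0..<1} - J s"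
      for x and k :: int
    proof -
      let ?c = "inv\<^bsub>thompson_T\<^esub> g \<otimes>\<^bsub>thompson_T\<^esub> s [^]\<^bsub>thompson_T\<^esub> k \<otimes>\<^bsub>thompson_T\<^esub> g"
      have "g \<otimes>\<^bsub>thompson_T\<^esub> ?c = s [^]\<^bsub>thompson_T\<^esub> k \<otimes>\<^bsub>thompson_T\<^esub> g"
        using g s by (simp add: T.m_assoc[symmetric])
      then have "g (?c x) = (s [^]\<^bsub>thompson_T\<^esub> k) (g x)" by (metis comp_apply thompson_T_simps(2))
      then show ?thesis using uv[OF into[OF x], of k] into[OF y] by simp
    qed
    with g show ?thesis by blast
  qed
  then obtain g where g: "\<And>s. s \<in> S \<Longrightarrow> g s \<in> carrier thompson_T" and
    ping: "\<And>s x (k::int). s \<in> S \<Longrightarrow> x \<in> {0..<1} - J s \<Longrightarrow>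
      (inv\<^bsub>thompson_T\<^esub> (g s) \<otimes>\<^bsub>thompson_T\<^esub> s [^]\<^bsub>thompson_T\<^esub> k \<otimes>\<^bsub>thompson_T\<^esub> g s) x \<in> {0..<1} - J s \<Longrightarrow>
      s [^]\<^bsub>thompson_T\<^esub> k = \<one>\<^bsub>thompson_T\<^esub>"
    by metis
  define c where "c s = inv\<^bsub>thompson_T\<^esub> (g s) \<otimes>\<^bsub>thompson_T\<^esub> s \<otimes>\<^bsub>thompson_T\<^esub> g s" for s
  have c: "c s \<in> carrier thompson_T" if "s \<in> S" for s
    unfolding c_def using g[OF that] S that by (intro T.m_closed T.inv_closed) auto
  define rot where "rot = (\<lambda>x::real. frac (x + of_int 1 / 2 ^ 2))"
  have "rot \<in> carrier thompson_T"
    unfolding rot_def by (rule thompson_TI[OF thompson_lift_translation[OF dyadic_div_power]])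
  then have rot: "rot \<in> generate thompson_T (c ` S)"
    using gen[of g] g unfolding c_def by auto
  have J_half: "x < 1 / 2" if "x \<in> J s" for x s
  proof -
    have "x < 1 / 2 ^ (idx s + 1)" using that by (simp add: J_def)
    also have "\<dots> \<le> 1 / 2" by (simp add: field_simps)
    finally show ?thesis .
  qed
  have "rot (1 / 2) = 1 / 2 \<or> (\<exists>s\<in>S. rot (1 / 2) \<in> J s)"
  proof (rule T.ping_pong[where X = "{0..<1}" and act = "\<lambda>f. f" and S = S and c = c and J = J])
    fix s t x assume st: "s \<in> S" "t \<in> S" "x \<in> J s" "x \<in> J t"
    \<comment> \<open>Two of the intervals can overlap only if their indices agree: each left end is
      below the other right end.\<close>
    have exponent: "b < a" if "1 / (2::real) ^ a < 1 / 2 ^ b" for a b :: nat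
    proof -
      have "(2::real) ^ b < 2 ^ a" using that by (simp add: field_simps)
      then show ?thesis by simp
    qed
    have "1 / (2::real) ^ (idx t + 2) < 1 / 2 ^ (idx s + 1)" "1 / (2::real) ^ (idx s + 2) < 1 / 2 ^ (idx t + 1)"
      using st(3,4) unfolding J_def by (simp_all only: atLeastLessThan_iff) linarith+
    from this[THEN exponent] have "idx s + 1 < idx t + 2" "idx t + 1 < idx s + 2" .
    then have "idx s = idx t" by simp
    then show "s = t" using idx st by (auto dest: inj_onD)
  next
    fix s x and k :: int
    assume s: "s \<in> S" and x: "x \<in> {0..<1}" "x \<notin> J s" and ne: "c s [^]\<^bsub>thompson_T\<^esub> k \<noteq> \<one>\<^bsub>thompson_T\<^esub>"
    have sT: "s \<in> carrier thompson_T" using S s by blast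
    have ck: "c s [^]\<^bsub>thompson_T\<^esub> k = inv\<^bsub>thompson_T\<^esub> (g s) \<otimes>\<^bsub>thompson_T\<^esub> s [^]\<^bsub>thompson_T\<^esub> k \<otimes>\<^bsub>thompson_T\<^esub> g s"
      unfolding c_def by (rule T.int_pow_conj[OF sT g[OF s]])
    have "s [^]\<^bsub>thompson_T\<^esub> k \<noteq> \<one>\<^bsub>thompson_T\<^esub>"
      using ne g[OF s] unfolding ck by auto
    then have "(c s [^]\<^bsub>thompson_T\<^esub> k) x \<notin> {0..<1} - J s"
      using ping[OF s, of x k] x unfolding ck by blast
    moreover have "(c s [^]\<^bsub>thompson_T\<^esub> k) x \<in> {0..<1}"
      using c[OF s] by (intro thompson_T_apply T.int_pow_closed)
    ultimately show "(c s [^]\<^bsub>thompson_T\<^esub> k) x \<in> J s" by blast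
  next
    show "(1 / 2 :: real) \<notin> J s" for s using J_half by blast
    show "rot \<in> generate thompson_T (c ` S)" by (rule rot)
  qed (simp_all add: c thompson_T_simps(2,3) thompson_T_apply(2) del: atLeastLessThan_iff, simp)
  moreover have "rot (1 / 2) = 3 / 4" by (simp add: rot_def frac_eq)
  ultimately have "\<exists>s. (3 / 4 :: real) \<in> J s" by auto
  then show False using J_half by fastforce
qed

end
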